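(* Let $N\ge3$ be an integer and $\alpha=\pi/N$. Let $\mathcal{H}$ be a Poncelet family of convex $N$-gons interscribed between two concentric, homothetic ellipses $\mathcal{E}_H$ (outer, with semiaxes $a_H,b_H$) and $\mathcal{E}_h$ (inner, with semiaxes $a_h\ge b_h$), both centered at $(0,0)$ with axes along the coordinate axes (the $a$'s along the $x$-axis). Let $c_h\ge 0$ with $c_h^2=a_h^2-b_h^2$ and let $f_h=(-c_h,0)$, a focus of $\mathcal{E}_h$. Then the polar image of $\mathcal{H}$ with respect to the unit circle centered at $f_h$ is a family of harmonic polygons inscribed in the circle with center $O_1$ and radius $R_1$ and circumscribing (i.e. with sides tangent to) an ellipse $\mathcal{E}_1$ centered at $(x_1,0)$ with semiaxes $(a_1,b_1)$ along the $x$- and $y$-directions respectively, where $$O_1=\left(-c_h\frac{1+b_h^2}{b_h^2},\,0\right),\qquad R_1=\frac{a_h}{b_h^2},$$ $$x_1=-\frac{c_h\left(a_h^2+(1-c_h^{2})\cos^2\alpha\right)}{k^2},\qquad a_1=\frac{a_h\cos\alpha}{k^2},\qquad b_1=\frac{a_h\cos\alpha}{b_h k},$$ with $k>0$ defined by $k^2=a_h^2-c_h^{2}\cos^2\alpha$. Furthermore, the symmedian point $K_1$ of the harmonic family coincides with $f_h$.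
   Context: An $N$-gon is interscribed between $\mathcal{E}_H$ and $\mathcal{E}_h$ if its vertices lie on $\mathcal{E}_H$ and its sides are tangent to $\mathcal{E}_h$. For convex $N$-gons and homothetic concentric ellipses this means that the family is an affine image of the family of regular $N$-gons, so $a_H=a_h/\cos\alpha$, $b_H=b_h/\cos\alpha$, and the members have consecutive vertices $(a_H\cos(2\alpha i+t),b_H\sin(2\alpha i+t))$, $i=1,\dots,N$, $t\in\mathbb{R}$. A polygon is harmonic if it is inscribed in a circle and there is an interior point $K$, its symmedian point, whose distance to each sideline is a fixed proportion of the corresponding sidelength. The polar image of a polygon with respect to a circle is the polygon whose vertices are the poles of the sidelines of the original polygon (consecutive sides giving consecutive vertices), so that its sidelines are the polars of the original vertices. *)

theory Defs
  imports "HOL-Analysis.Analysis"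
begin

type_synonym point = "real \<times> real"

text \<open>A polygon is the cyclic list of its vertices; its \<open>i\<close>-th side joins
  \<open>vertex P i\<close> to \<open>vertex P (Suc i)\<close>, indices being taken modulo the length.\<close>

definition vertex :: "point list \<Rightarrow> nat \<Rightarrow> point" where
  "vertex P i = P ! (i mod length P)"

definition side :: "point list \<Rightarrow> nat \<Rightarrow> point set" where
  "side P i = closed_segment (vertex P i) (vertex P (Suc i))"

definition sideline :: "point list \<Rightarrow> nat \<Rightarrow> point set" where
  "sideline P i = affine hull {vertex P i, vertex P (Suc i)}"

text \<open>Strict convexity: for every side, all vertices that are not endpoints of the side lie in
  the same open half-plane bounded by the sideline. (With at least three vertices this forces the
  normal \<open>n\<close> to be nonzero, all vertices to be distinct, and the cyclic order of the list to be
  the order of the vertices along the boundary of the convex hull, in either orientation.)\<close>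

definition convex_polygon :: "point list \<Rightarrow> bool" where
  "convex_polygon P \<longleftrightarrow> 3 \<le> length P \<and>
     (\<forall>i<length P. \<exists>n c. n \<bullet> vertex P i = c \<and> n \<bullet> vertex P (Suc i) = c \<and>
        (\<forall>j<length P. j \<noteq> i \<and> j \<noteq> Suc i mod length P \<longrightarrow> n \<bullet> vertex P j < c))"

definition ellipse :: "point \<Rightarrow> real \<Rightarrow> real \<Rightarrow> point set" where
  "ellipse C a b = {p. ((fst p - fst C) / a)\<^sup>2 + ((snd p - snd C) / b)\<^sup>2 = 1}"

text \<open>A line is tangent to an ellipse iff it meets it in exactly one point. A side is tangent if
  its sideline is and the point of contact lies on the side itself.\<close>

definition side_tangent :: "point list \<Rightarrow> nat \<Rightarrow> point set \<Rightarrow> bool" where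
  "side_tangent P i E \<longleftrightarrow> (\<exists>T \<in> side P i. sideline P i \<inter> E = {T})"

definition inscribed_in :: "point list \<Rightarrow> point set \<Rightarrow> bool" where
  "inscribed_in P E \<longleftrightarrow> set P \<subseteq> E"

definition circumscribes :: "point list \<Rightarrow> point set \<Rightarrow> bool" where
  "circumscribes P E \<longleftrightarrow> (\<forall>i<length P. side_tangent P i E)"

definition interscribed :: "point list \<Rightarrow> point set \<Rightarrow> point set \<Rightarrow> bool" where
  "interscribed P E\<^sub>o E\<^sub>i \<longleftrightarrow> inscribed_in P E\<^sub>o \<and> circumscribes P E\<^sub>i"

definition poncelet_family :: "nat \<Rightarrow> point set \<Rightarrow> point set \<Rightarrow> point list set" where
  "poncelet_family N E\<^sub>o E\<^sub>i = {P. length P = N \<and> convex_polygon P \<and> interscribed P E\<^sub>o E\<^sub>i}"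

definition polar :: "point \<Rightarrow> real \<Rightarrow> point \<Rightarrow> point set" where
  "polar C r p = {q. (q - C) \<bullet> (p - C) = r\<^sup>2}"

text \<open>Only meaningful for a line that does not pass through the center \<open>C\<close>.\<close>

definition pole :: "point \<Rightarrow> real \<Rightarrow> point set \<Rightarrow> point" where
  "pole C r L = (THE p. polar C r p = L)"

definition polar_image :: "point \<Rightarrow> real \<Rightarrow> point list \<Rightarrow> point list" where
  "polar_image C r P = map (\<lambda>i. pole C r (sideline P i)) [0..<length P]"

definition is_symmedian_point :: "point list \<Rightarrow> point \<Rightarrow> bool" where
  "is_symmedian_point P K \<longleftrightarrow> K \<in> interior (convex hull set P) \<and>
     (\<exists>\<kappa>. \<forall>i<length P.
        infdist K (sideline P i) = \<kappa> * dist (vertex P i) (vertex P (Suc i)))"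

text \<open>Convexity makes \<open>interior (convex hull set P)\<close> the interior of the polygon.\<close>

definition harmonic_polygon :: "point list \<Rightarrow> bool" where
  "harmonic_polygon P \<longleftrightarrow> convex_polygon P \<and>
     (\<exists>C R. inscribed_in P (sphere C R)) \<and> (\<exists>K. is_symmedian_point P K)"

text \<open>The affine images of the regular \<open>N\<close>-gons belong to the Poncelet family.\<close>

lemma affine_regular_in_poncelet_family:
  fixes a b \<alpha> t :: real
  assumes N: "3 \<le> N" and \<alpha>: "\<alpha> = pi / real N" and ab: "0 < a" "0 < b"
  shows "map (\<lambda>i. (a / cos \<alpha> * cos (2 * \<alpha> * real i + t), b / cos \<alpha> * sin (2 * \<alpha> * real i + t))) [0..<N]
           \<in> poncelet_family N (ellipse (0, 0) (a / cos \<alpha>) (b / cos \<alpha>)) (ellipse (0, 0) a b)"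
proof -
  define V where "V i = (a / cos \<alpha> * cos (2 * \<alpha> * real i + t), b / cos \<alpha> * sin (2 * \<alpha> * real i + t))" for i
  define P where "P = map V [0..<N]"
  have N\<alpha>: "\<alpha> * real N = pi" using N \<alpha> by simp
  have \<alpha>0: "0 < \<alpha>" using N \<alpha> by simp
  have "3 * \<alpha> \<le> \<alpha> * real N" using N \<alpha>0 by simp
  then have \<alpha>2: "\<alpha> < pi / 2" using N\<alpha> \<alpha>0 by linarith
  have c0: "0 < cos \<alpha>" using \<alpha>0 \<alpha>2 by (simp add: cos_gt_zero)
  have len: "length P = N" by (simp add: P_def)
  have v: "vertex P i = V i" if "i < N" for i
    using that by (simp add: vertex_def P_def)
  have V_N: "V N = V 0"
  proof -
    have "2 * \<alpha> * real N + t = t + 2 * pi" using N\<alpha> by (simp add: algebra_simps)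
    then have "cos (2 * \<alpha> * real N + t) = cos t" "sin (2 * \<alpha> * real N + t) = sin t"
      by (simp_all only: cos_periodic sin_periodic)
    then show ?thesis by (simp add: V_def)
  qed
  have vS: "vertex P (Suc i) = V (Suc i)" if "i < N" for i
  proof (cases "Suc i = N")
    case True
    then show ?thesis using V_N N by (simp add: vertex_def P_def len)
  next
    case False
    then show ?thesis using that v by simp
  qed
  define n where "n i = (cos ((2 * real i + 1) * \<alpha> + t) / a, sin ((2 * real i + 1) * \<alpha> + t) / b)" for i
  have nV: "n i \<bullet> V j = cos ((2 * real j - 2 * real i - 1) * \<alpha>) / cos \<alpha>" for i j
  proof -
    have "(2 * real j - 2 * real i - 1) * \<alpha>
        = (2 * \<alpha> * real j + t) - ((2 * real i + 1) * \<alpha> + t)"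
      by (simp add: algebra_simps)
    then have "cos ((2 * real j - 2 * real i - 1) * \<alpha>)
        = cos (2 * \<alpha> * real j + t) * cos ((2 * real i + 1) * \<alpha> + t)
        + sin (2 * \<alpha> * real j + t) * sin ((2 * real i + 1) * \<alpha> + t)"
      by (simp only: cos_diff)
    then show ?thesis using ab c0 by (simp add: n_def V_def field_simps)
  qed
  have nVi: "n i \<bullet> V i = 1" for i
    using c0 by (simp add: nV)
  have nVS: "n i \<bullet> V (Suc i) = 1" for i
    using c0 by (simp add: nV algebra_simps)
  have nVj: "n i \<bullet> V j < 1" if ij: "i < N" "j < N" "j \<noteq> i" "j \<noteq> Suc i mod N" for i j
  proof -
    define d where "d = \<bar>2 * real j - 2 * real i - 1\<bar>"
    have "\<bar>2 * int j - 2 * int i - 1\<bar> \<ge> 3 \<and> \<bar>2 * int j - 2 * int i - 1\<bar> \<le> 2 * int N - 3"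
    proof (cases "Suc i = N")
      case True
      then show ?thesis using ij by auto
    next
      case False
      then have "j \<noteq> Suc i" using ij by simp
      then show ?thesis using ij False by auto
    qed
    moreover have "d = real_of_int \<bar>2 * int j - 2 * int i - 1\<bar>" by (simp add: d_def)
    ultimately have "real_of_int 3 \<le> d" "d \<le> real_of_int (2 * int N - 3)"
      by (metis of_int_le_iff)+
    then have d: "3 \<le> d" "d \<le> 2 * real N - 3" by simp_all
    have "cos ((2 * real j - 2 * real i - 1) * \<alpha>) = cos (\<bar>(2 * real j - 2 * real i - 1) * \<alpha>\<bar>)"
      by simp
    also have "\<dots> = cos (d * \<alpha>)" using \<alpha>0 by (simp add: d_def abs_mult)
    also have "\<dots> < cos \<alpha>"
    proof (cases "d \<le> real N")
      case True
      have "d * \<alpha> \<le> real N * \<alpha>" using True \<alpha>0 by simp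
      then have "d * \<alpha> \<le> pi" using N\<alpha> by (simp add: mult.commute)
      moreover have "\<alpha> < d * \<alpha>" using d \<alpha>0 by simp
      ultimately show ?thesis using \<alpha>0 by (intro cos_monotone_0_pi) auto
    next
      case False
      define e where "e = 2 * real N - d"
      have "d * \<alpha> = 2 * pi - e * \<alpha>" using N\<alpha> by (simp add: e_def algebra_simps)
      then have "cos (d * \<alpha>) = cos (e * \<alpha>)" by (simp add: cos_diff)
      moreover have "e * \<alpha> \<le> real N * \<alpha>" using False \<alpha>0 by (simp add: e_def)
      then have "e * \<alpha> \<le> pi" using N\<alpha> by (simp add: mult.commute)
      moreover have "\<alpha> < e * \<alpha>" using d \<alpha>0 by (simp add: e_def)
      then have "cos (e * \<alpha>) < cos \<alpha>" using \<alpha>0 \<open>e * \<alpha> \<le> pi\<close> by (intro cos_monotone_0_pi) auto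
      ultimately show ?thesis by simp
    qed
    finally show ?thesis using c0 by (simp add: nV)
  qed
  have "convex_polygon P"
    unfolding convex_polygon_def len
  proof (intro conjI allI impI)
    fix i assume i: "i < N"
    show "\<exists>m c. m \<bullet> vertex P i = c \<and> m \<bullet> vertex P (Suc i) = c \<and>
        (\<forall>j<N. j \<noteq> i \<and> j \<noteq> Suc i mod N \<longrightarrow> m \<bullet> vertex P j < c)"
      by (rule exI[of _ "n i"], rule exI[of _ 1]) (use i in \<open>simp add: v vS nVi nVS nVj\<close>)
  qed (use N in simp)
  moreover have "inscribed_in P (ellipse (0, 0) (a / cos \<alpha>) (b / cos \<alpha>))"
    using ab c0 by (auto simp: inscribed_in_def P_def V_def ellipse_def)
  moreover have "circumscribes P (ellipse (0, 0) a b)"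
    unfolding circumscribes_def len
  proof (intro allI impI)
    fix i assume i: "i < N"
    define \<phi> where "\<phi> = (2 * real i + 1) * \<alpha> + t"
    define T where "T = (a * cos \<phi>, b * sin \<phi>)"
    have ang: "2 * \<alpha> * real i + t = \<phi> - \<alpha>" "2 * \<alpha> * real (Suc i) + t = \<phi> + \<alpha>"
      by (simp_all add: \<phi>_def algebra_simps)
    have "T = (1/2) *\<^sub>R V i + (1/2) *\<^sub>R V (Suc i)"
      unfolding V_def ang T_def
      using c0 by (simp add: cos_add cos_diff sin_add sin_diff field_simps)
    then have mid: "T = midpoint (V i) (V (Suc i))"
      by (simp add: midpoint_def scaleR_add_right)
    then have T_side: "T \<in> side P i"
      using i by (simp add: side_def v vS)
    then have T_line: "T \<in> sideline P i"
      using convex_hull_subset_affine_hull[of "{vertex P i, vertex P (Suc i)}"]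
      by (auto simp: side_def sideline_def segment_convex_hull)
    have T_ell: "T \<in> ellipse (0, 0) a b"
      using ab by (simp add: T_def ellipse_def)
    have "q = T" if q: "q \<in> sideline P i" "q \<in> ellipse (0, 0) a b" for q
    proof -
      obtain u w where uw: "u + w = 1" "q = u *\<^sub>R V i + w *\<^sub>R V (Suc i)"
        using q i by (auto simp: sideline_def v vS affine_hull_2)
      then have nq: "n i \<bullet> q = 1" by (simp add: inner_add_right nVi nVS)
      define x y where "x = fst q / a" and "y = snd q / b"
      have 1: "x\<^sup>2 + y\<^sup>2 = 1" using q by (simp add: ellipse_def x_def y_def)
      have 2: "cos \<phi> * x + sin \<phi> * y = 1"
        using nq by (cases q) (simp add: n_def x_def y_def \<phi>_def)
      have "(x - cos \<phi>)\<^sup>2 + (y - sin \<phi>)\<^sup>2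
          = x\<^sup>2 + y\<^sup>2 + ((sin \<phi>)\<^sup>2 + (cos \<phi>)\<^sup>2) - 2 * (cos \<phi> * x + sin \<phi> * y)"
        by (simp add: power2_eq_square algebra_simps)
      then have "(x - cos \<phi>)\<^sup>2 + (y - sin \<phi>)\<^sup>2 = 0" using 1 2 by simp
      then have "x = cos \<phi>" "y = sin \<phi>" by (simp_all add: sum_power2_eq_zero_iff)
      then show "q = T" using ab by (cases q) (auto simp: x_def y_def T_def field_simps)
    qed
    then show "side_tangent P i (ellipse (0, 0) a b)"
      unfolding side_tangent_def using T_side T_line T_ell by blast
  qed
  ultimately have "P \<in> poncelet_family N (ellipse (0, 0) (a / cos \<alpha>) (b / cos \<alpha>)) (ellipse (0, 0) a b)"
    by (simp add: poncelet_family_def interscribed_def len)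
  then show ?thesis by (simp only: P_def V_def[abs_def])
qed

end

theory Submission
  imports Defs
begin

text \<open>In the coordinates \<open>(x / a, y / b)\<close> the inner ellipse is the unit circle and a side of a
  polygon of the family is a chord of the circle of radius \<open>1 / cos \<beta>\<close> touching it, so consecutive
  vertices differ by an angle \<open>\<plusminus>2 * \<beta>\<close>. Distinctness of the vertices fixes the sign, and convexity
  forces the polygon to close after one turn, so \<open>\<beta> = \<alpha>\<close> and the polygon is affinely regular.

  The pole of the tangent of the inner ellipse at the parameter \<open>x\<close> is, relative to the focus,
  \<open>(cos x, a / b * sin x) / (a + c * cos x)\<close>. These poles lie on a circle, and the sidelines of the
  polar polygon are the lines \<open>n \<bullet> (q - f) = 1\<close> with \<open>n = V - f\<close> for the original vertices \<open>V\<close>.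
  The focus has distance \<open>1 / norm n\<close> from such a line, and the length of the corresponding side turns
  out to be a constant multiple of \<open>1 / norm n\<close> as well.\<close>

section \<open>Lines, hyperplanes, convex hulls and polars\<close>

lemma cos_sin_add_2pi_int:
  fixes x :: real and n :: int
  shows "cos (x + 2 * pi * of_int n) = cos x" "sin (x + 2 * pi * of_int n) = sin x"
  using sin_cos_eq_iff[of "x + 2 * pi * of_int n" x] by auto

lemma affine_hull_eq_line:
  fixes p q n :: point
  assumes "p \<noteq> q" "n \<noteq> 0" "n \<bullet> p = d" "n \<bullet> q = d"
  shows "affine hull {p, q} = {x. n \<bullet> x = d}"
proof (intro set_eqI iffI)
  fix x assume "x \<in> affine hull {p, q}"
  then obtain u v where "u + v = 1" "x = u *\<^sub>R p + v *\<^sub>R q" by (auto simp: affine_hull_2)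
  then show "x \<in> {x. n \<bullet> x = d}"
    using assms by (simp add: inner_add_right flip: distrib_right)
next
  fix x assume "x \<in> {x. n \<bullet> x = d}"
  then have x: "n \<bullet> (x - p) = 0" using assms by (simp add: inner_diff_right)
  have q: "n \<bullet> (q - p) = 0" using assms by (simp add: inner_diff_right)
  obtain n1 n2 where n: "n = (n1, n2)" by (cases n)
  obtain d1 d2 where d12: "q - p = (d1, d2)" by (cases "q - p")
  obtain e1 e2 where e12: "x - p = (e1, e2)" by (cases "x - p")
  define s where "s = d1\<^sup>2 + d2\<^sup>2"
  have s0: "s \<noteq> 0" using assms(1) d12 right_minus_eq[of q p]
    by (auto simp: s_def sum_power2_eq_zero_iff zero_prod_def simp del: right_minus_eq)
  have 1: "n1 * d1 + n2 * d2 = 0" "n1 * e1 + n2 * e2 = 0"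
    using q x by (simp_all add: n d12 e12)
  \<comment> \<open>Both \<open>x - p\<close> and \<open>q - p\<close> are orthogonal to the nonzero
    \<open>n\<close>, so in the plane their determinant vanishes. Hence \<open>x - p\<close> equals
    its orthogonal projection onto \<open>q - p\<close>, which supplies the coefficient used
    below.\<close>
  have "n1 * (d1 * e2 - d2 * e1) = 0" "n2 * (d1 * e2 - d2 * e1) = 0"
    using 1 by algebra+
  then have 2: "d1 * e2 = d2 * e1" using assms(2) n by (auto simp: zero_prod_def)
  have "e1 * s - (e1 * d1 + e2 * d2) * d1 = - d2 * (d1 * e2 - d2 * e1)"
    "e2 * s - (e1 * d1 + e2 * d2) * d2 = d1 * (d1 * e2 - d2 * e1)"
    by (simp_all add: s_def power2_eq_square algebra_simps)
  then have "e1 * s = (e1 * d1 + e2 * d2) * d1" "e2 * s = (e1 * d1 + e2 * d2) * d2"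
    using 2 by simp_all
  then have "x - p = ((e1 * d1 + e2 * d2) / s) *\<^sub>R (q - p)"
    using s0 by (simp add: d12 e12 field_simps)
  then have "x = (1 - (e1 * d1 + e2 * d2) / s) *\<^sub>R p + ((e1 * d1 + e2 * d2) / s) *\<^sub>R q"
    by (simp add: algebra_simps)
  then show "x \<in> affine hull {p, q}"
    unfolding affine_hull_2 mem_Collect_eq
    by (intro exI[of _ "1 - (e1 * d1 + e2 * d2) / s"] exI[of _ "(e1 * d1 + e2 * d2) / s"]) simp
qed

lemma infdist_hyperplane:
  fixes n x :: "'a::euclidean_space"
  assumes "n \<noteq> 0"
  shows "infdist x {y. n \<bullet> y = d} = \<bar>d - n \<bullet> x\<bar> / norm n"
proof (rule antisym)
  have n0: "n \<bullet> n \<noteq> 0" "norm n > 0" using assms by auto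
  define z where "z = x + ((d - n \<bullet> x) / (n \<bullet> n)) *\<^sub>R n"
  have z: "z \<in> {y. n \<bullet> y = d}" using n0 by (simp add: z_def inner_add_right)
  have "dist x z = \<bar>(d - n \<bullet> x) / (n \<bullet> n)\<bar> * norm n"
    by (simp add: z_def dist_norm)
  also have "\<dots> = \<bar>d - n \<bullet> x\<bar> / norm n"
    using n0(2) by (simp add: abs_divide dot_square_norm power2_eq_square)
  finally show "infdist x {y. n \<bullet> y = d} \<le> \<bar>d - n \<bullet> x\<bar> / norm n"
    using infdist_le[OF z, of x] by simp
  have "{y. n \<bullet> y = d} \<noteq> {}" using z by blast
  then obtain y where y: "n \<bullet> y = d" "infdist x {y. n \<bullet> y = d} = dist x y"
    using infdist_attains_inf[OF closed_hyperplane[of n d], of x] by auto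
  have "\<bar>d - n \<bullet> x\<bar> = \<bar>n \<bullet> (y - x)\<bar>" using y by (simp add: inner_diff_right)
  also have "\<dots> \<le> norm n * norm (y - x)" by (rule Cauchy_Schwarz_ineq2)
  finally have "\<bar>d - n \<bullet> x\<bar> / norm n \<le> norm (y - x)"
    using n0(2) by (simp add: pos_divide_le_eq mult.commute)
  then show "\<bar>d - n \<bullet> x\<bar> / norm n \<le> infdist x {y. n \<bullet> y = d}"
    using y(2) by (simp add: dist_norm norm_minus_commute)
qed

text \<open>A point outside the interior would be separated from it by a hyperplane. The separation
  bounds only the interior, but when that is nonempty its closure contains \<open>S\<close>, so no
  point of \<open>S\<close> lies beyond \<open>z\<close> in the separating direction. If the
  interior is empty, \<open>S\<close> lies in a hyperplane, and the assumption for \<open>w\<close>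
  and for \<open>- w\<close> gives a contradiction.\<close>

lemma in_interior_convex_hullI:
  fixes S :: "'a::euclidean_space set"
  assumes *: "\<And>w. w \<noteq> 0 \<Longrightarrow> \<exists>x\<in>S. w \<bullet> z < w \<bullet> x"
  shows "z \<in> interior (convex hull S)"
proof (cases "interior (convex hull S) = {}")
  case True
  then obtain w d where w: "w \<noteq> 0" "convex hull S \<subseteq> {x. w \<bullet> x = d}"
    using empty_interior_subset_hyperplane[of "convex hull S"] by (metis convex_convex_hull)
  then have "\<And>x. x \<in> S \<Longrightarrow> w \<bullet> x = d" using hull_subset[of S convex] by auto
  moreover obtain x where "x \<in> S" "w \<bullet> z < w \<bullet> x" using *[OF w(1)] by blast
  moreover obtain y where "y \<in> S" "- w \<bullet> z < - w \<bullet> y" using *[of "- w"] w(1) by auto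
  ultimately show ?thesis by fastforce
next
  case False
  show ?thesis
  proof (rule ccontr)
    assume "z \<notin> interior (convex hull S)"
    then obtain w d where w: "w \<noteq> 0" "\<forall>x\<in>interior (convex hull S). w \<bullet> x \<le> d" "\<forall>x\<in>{z}. w \<bullet> x \<ge> d"
      using separating_hyperplane_sets[OF convex_interior[OF convex_convex_hull[of S]] convex_singleton False, of z]
      by blast
    have z: "d \<le> w \<bullet> z" using w(3) by blast
    have "S \<subseteq> closure (convex hull S)" by (rule order_trans[OF hull_subset closure_subset])
    also have "\<dots> = closure (interior (convex hull S))"
      using convex_closure_interior[OF _ False] by simp
    also have "\<dots> \<subseteq> {x. w \<bullet> x \<le> d}"
      using w(2) by (intro closure_minimal closed_halfspace_le) blast
    finally have S: "S \<subseteq> {x. w \<bullet> x \<le> d}" .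
    obtain x where "x \<in> S" "w \<bullet> z < w \<bullet> x" using *[OF w(1)] by blast
    then have "w \<bullet> x \<le> d" using S by blast
    then show False using z \<open>w \<bullet> z < w \<bullet> x\<close> by linarith
  qed
qed

text \<open>A nonempty polar excludes the centre as its point. The inverse of \<open>p\<close> in
  the circle, which is the foot of the perpendicular from \<open>C\<close>, lies on the polar of
  \<open>p\<close> and hence on that of \<open>q\<close>. This gives one inner product identity;
  exchanging \<open>p\<close> and \<open>q\<close> gives another, and together they make the squared
  length of \<open>p - q\<close> zero.\<close>

lemma polar_inject:
  assumes eq: "polar C r p = polar C r q" and ne: "polar C r p \<noteq> {}" and r: "r \<noteq> 0"
  shows "p = q"
proof -
  have key: "w \<bullet> v = w \<bullet> w" if "w = p' - C" "v = q' - C" "polar C r p' = polar C r q'"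
    "polar C r p' \<noteq> {}" for w v p' q'
  proof -
    have w0: "w \<noteq> 0" using that r by (auto simp: polar_def)
    then have "C + (r\<^sup>2 / (w \<bullet> w)) *\<^sub>R w \<in> polar C r p'" using that(1) by (simp add: polar_def)
    then have "C + (r\<^sup>2 / (w \<bullet> w)) *\<^sub>R w \<in> polar C r q'" using that(3) by simp
    then have "(r\<^sup>2 / (w \<bullet> w)) * (w \<bullet> v) = r\<^sup>2" using that(2) by (simp add: polar_def)
    then show ?thesis using r w0 by (simp add: field_simps)
  qed
  have "(p - C) \<bullet> (q - C) = (p - C) \<bullet> (p - C)" "(q - C) \<bullet> (p - C) = (q - C) \<bullet> (q - C)"
    using key[of "p - C" p "q - C" q] key[of "q - C" q "p - C" p] eq ne by auto
  then have "((p - C) - (q - C)) \<bullet> ((p - C) - (q - C)) = 0"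
    by (simp add: inner_diff_left inner_diff_right inner_commute)
  then show ?thesis by simp
qed

lemma pole_eqI:
  assumes "polar C r p = L" "L \<noteq> {}" "r \<noteq> 0"
  shows "pole C r L = p"
  unfolding pole_def
proof (rule the_equality)
  fix q assume "polar C r q = L"
  then show "q = p" using assms by (intro polar_inject[of C r q p]) simp_all
qed (rule assms)

section \<open>Cyclic indices and polar images of polygons\<close>

lemma vertex_mod: "vertex P (i mod length P) = vertex P i"
  by (simp add: vertex_def)

lemma vertex_Suc_mod: "vertex P (Suc (i mod length P)) = vertex P (Suc i)"
  by (simp add: vertex_def mod_Suc_eq)

lemma side_mod: "side P (i mod length P) = side P i" "sideline P (i mod length P) = sideline P i"
  by (simp_all add: side_def sideline_def vertex_mod vertex_Suc_mod)

lemma length_polar_image: "length (polar_image C r P) = length P"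
  by (simp add: polar_image_def)

lemma vertex_polar_image:
  assumes "P \<noteq> []"
  shows "vertex (polar_image C r P) i = pole C r (sideline P i)"
proof -
  have "vertex (polar_image C r P) i = pole C r (sideline P (i mod length P))"
    unfolding vertex_def[of "polar_image C r P"] length_polar_image
    using assms by (simp add: polar_image_def)
  then show ?thesis by (simp add: side_mod)
qed

lemma set_eq_vertex_image: "P \<noteq> [] \<Longrightarrow> set P = vertex P ` {..<length P}"
  by (simp add: set_conv_nth vertex_def image_def lessThan_def Bex_def conj_commute cong: conj_cong)

section \<open>Affinely regular polygons and the trigonometry of their angular step\<close>

lemma unit_vectors_orthogonal_imp_zero:
  fixes u v x \<delta> :: real
  assumes "u * cos (x - \<delta>) + v * sin (x - \<delta>) = 0" "u * cos (x + \<delta>) + v * sin (x + \<delta>) = 0"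
    and "cos \<delta> \<noteq> 0" "sin \<delta> \<noteq> 0"
  shows "u = 0" "v = 0"
proof -
  have "cos \<delta> * (u * cos x + v * sin x) = 0" "sin \<delta> * (v * cos x - u * sin x) = 0"
    using assms(1,2) unfolding cos_add cos_diff sin_add sin_diff by algebra+
  then have *: "u * cos x + v * sin x = 0" "v * cos x - u * sin x = 0"
    using assms by auto
  have "u * ((sin x)\<^sup>2 + (cos x)\<^sup>2) = 0" "v * ((sin x)\<^sup>2 + (cos x)\<^sup>2) = 0"
    using * by algebra+
  then show "u = 0" "v = 0" by simp_all
qed

text \<open>The sign of \<open>\<delta>\<close> is the orientation of the vertex list, since a
  member of the family may run either way round. The condition on its absolute value says that the
  polygon closes after exactly one turn.\<close>

locale affine_regular_polygon =
  fixes N :: nat and a b c \<delta> t :: real and P :: "point list"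
  assumes N: "3 \<le> N" and a: "0 < a" and b: "0 < b" and c: "0 \<le> c" and c2: "c\<^sup>2 = a\<^sup>2 - b\<^sup>2"
    and \<delta>: "real N * \<bar>\<delta>\<bar> = pi"
    and length_P: "length P = N"
    and vertex_P: "vertex P i = (a / cos \<delta> * cos (t + 2 * \<delta> * real i), b / cos \<delta> * sin (t + 2 * \<delta> * real i))"
begin

definition outer :: "real \<Rightarrow> point" where
  "outer x = (a / cos \<delta> * cos x, b / cos \<delta> * sin x)"

definition focus :: point where
  "focus = (- c, 0)"

text \<open>This is the distance from the focus to the point \<open>(a * cos x, b * sin x)\<close>
  of the inner ellipse.\<close>

definition den :: "real \<Rightarrow> real" where
  "den x = a + c * cos x"

definition dual :: "real \<Rightarrow> point" where
  "dual x = (cos x / den x - c, a * sin x / (b * den x))"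

lemma sin_mult_pos: "0 < x \<Longrightarrow> x < real N \<Longrightarrow> 0 < sin (x * \<bar>\<delta>\<bar>)"
proof -
  assume x: "0 < x" "x < real N"
  have "0 < \<bar>\<delta>\<bar>" using \<delta> by (metis abs_ge_zero less_eq_real_def mult_zero_right pi_neq_zero)
  then have "x * \<bar>\<delta>\<bar> < real N * \<bar>\<delta>\<bar>" "0 < x * \<bar>\<delta>\<bar>" using x by simp_all
  then show ?thesis using \<delta> by (intro sin_gt_zero) auto
qed

lemma \<delta>_bounds: "0 < \<bar>\<delta>\<bar>" "\<bar>\<delta>\<bar> < pi / 2"
proof -
  show "0 < \<bar>\<delta>\<bar>" using \<delta> by (metis abs_ge_zero less_eq_real_def mult_zero_right pi_neq_zero)
  moreover have "3 * \<bar>\<delta>\<bar> \<le> real N * \<bar>\<delta>\<bar>" using N by (intro mult_right_mono) simp_all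
  ultimately show "\<bar>\<delta>\<bar> < pi / 2" using \<delta> by linarith
qed

lemma cos_\<delta>_pos: "0 < cos \<delta>"
  using \<delta>_bounds by (intro cos_gt_zero_pi) (auto simp: abs_if split: if_splits)

lemma sin_\<delta>_nonzero: "sin \<delta> \<noteq> 0"
  using sin_mult_pos[of 1] N by (auto simp: abs_if split: if_splits)

lemma sin_2\<delta>_nonzero: "sin (2 * \<delta>) \<noteq> 0"
  using sin_\<delta>_nonzero cos_\<delta>_pos by (simp add: sin_double)

lemma full_turn: "cos (2 * \<delta> * real N) = 1" "sin (2 * \<delta> * real N) = 0"
proof -
  have "2 * \<delta> * real N = 2 * pi \<or> 2 * \<delta> * real N = - (2 * pi)"
    using \<delta> by (auto simp: abs_if mult.commute split: if_splits)
  then show "cos (2 * \<delta> * real N) = 1" "sin (2 * \<delta> * real N) = 0"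
    by (elim disjE; simp only: cos_minus sin_minus cos_two_pi sin_two_pi minus_zero)+
qed

text \<open>Product-to-sum turns the difference of the two cosines into twice
  \<open>sin (e * \<delta>) * sin ((e - 1) * \<delta>)\<close>, and in this range both sines have
  the same sign. With \<open>e\<close> a difference of indices, this is the inequality behind the
  convexity of the polar polygon.\<close>

lemma cos_odd_multiple_less:
  fixes e :: int
  assumes "2 \<le> e \<and> e < int N \<or> 1 - int N < e \<and> e < 0"
  shows "cos ((2 * of_int e - 1) * \<delta>) < cos \<delta>"
proof -
  define e' where "e' = real_of_int e"
  have s: "0 < sin (e' * \<bar>\<delta>\<bar>) * sin ((e' - 1) * \<bar>\<delta>\<bar>)"
    using assms
  proof
    assume "2 \<le> e \<and> e < int N"
    then have "2 \<le> e'" "e' < real N" by (auto simp: e'_def)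
    then show ?thesis by (intro mult_pos_pos sin_mult_pos) auto
  next
    assume e: "1 - int N < e \<and> e < 0"
    then have "real_of_int (1 - int N) < real_of_int e" "e' < 0"
      unfolding of_int_less_iff e'_def by auto
    then have "1 - real N < e'" "e' < 0" by (simp_all add: e'_def)
    then have "0 < sin (- e' * \<bar>\<delta>\<bar>)" "0 < sin ((1 - e') * \<bar>\<delta>\<bar>)"
      using sin_mult_pos[of "- e'"] sin_mult_pos[of "1 - e'"] by simp_all
    moreover have "(e' - 1) * \<bar>\<delta>\<bar> = - ((1 - e') * \<bar>\<delta>\<bar>)" by (simp add: algebra_simps)
    ultimately show ?thesis by (simp add: mult_neg_pos)
  qed
  have "sin (e' * \<delta>) * sin ((e' - 1) * \<delta>) = sin (e' * \<bar>\<delta>\<bar>) * sin ((e' - 1) * \<bar>\<delta>\<bar>)"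
    by (cases "\<delta> \<ge> 0") (simp_all add: abs_if)
  moreover have "cos (e' * \<delta> - (e' - 1) * \<delta>) - cos (e' * \<delta> + (e' - 1) * \<delta>)
      = 2 * (sin (e' * \<delta>) * sin ((e' - 1) * \<delta>))"
    unfolding cos_add cos_diff by simp
  moreover have "e' * \<delta> - (e' - 1) * \<delta> = \<delta>" "e' * \<delta> + (e' - 1) * \<delta> = (2 * e' - 1) * \<delta>"
    by (simp_all add: algebra_simps)
  ultimately show ?thesis using s by (simp add: e'_def)
qed

lemma c_less_a: "c < a"
proof (rule power2_less_imp_less)
  show "c\<^sup>2 < a\<^sup>2" using c2 b by simp
qed (use a in simp)

lemma abs_c_cos_le: "\<bar>c * cos x\<bar> \<le> c"
  using c by (simp add: abs_mult mult_left_le)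

lemma den_pos: "0 < den x"
  using abs_c_cos_le[of x] c_less_a by (simp add: den_def abs_le_iff)

text \<open>The comparison of \<open>cos (y - x)\<close> with \<open>cos \<delta>\<close> decides
  everything: equality means that \<open>outer y\<close> lies on the polar of \<open>dual x\<close>,
  and a smaller cosine gives a value below 1. Incidence, sidelines and convexity are all read off
  from this formula.\<close>

lemma pairing:
  "(outer y - focus) \<bullet> (dual x - focus) = 1 - a * (1 - cos (y - x) / cos \<delta>) / den x"
proof -
  have "(outer y - focus) \<bullet> (dual x - focus)
      = (a * (cos y * cos x + sin y * sin x) / cos \<delta> + c * cos x) / den x"
    using den_pos[of x] cos_\<delta>_pos b by (simp add: outer_def focus_def dual_def field_simps)
  also have "c * cos x = den x - a" by (simp add: den_def)
  finally show ?thesis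
    using den_pos[of x] cos_\<delta>_pos by (simp add: cos_diff field_simps)
qed

lemma pairing_adjacent [simp]:
  "(outer y - focus) \<bullet> (dual (y + \<delta>) - focus) = 1"
  "(outer y - focus) \<bullet> (dual (y - \<delta>) - focus) = 1"
  using cos_\<delta>_pos by (simp_all add: pairing)

lemma cos_3\<delta>_less: "cos (3 * \<delta>) < cos \<delta>"
  using cos_odd_multiple_less[of 2] N by simp

text \<open>If the two points coincided, the first would also lie on the polar of
  \<open>dual (x + 2 * \<delta>)\<close>, which passes through the second. Its parameter differs
  from that one by three steps, and \<open>cos (3 * \<delta>)\<close> is too small for
  incidence.\<close>

lemma outer_neq: "outer (x - \<delta>) \<noteq> outer (x + \<delta>)"
proof
  assume "outer (x - \<delta>) = outer (x + \<delta>)"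
  then have "(outer (x - \<delta>) - focus) \<bullet> (dual (x + 2 * \<delta>) - focus) = 1"
    using pairing_adjacent(1)[of "x + \<delta>"] by (simp add: add.commute add.left_commute)
  then have "cos (x - \<delta> - (x + 2 * \<delta>)) = cos \<delta>"
    using den_pos[of "x + 2 * \<delta>"] a cos_\<delta>_pos by (simp add: pairing)
  moreover have "x - \<delta> - (x + 2 * \<delta>) = - (3 * \<delta>)" by simp
  ultimately show False using cos_3\<delta>_less by (simp only: cos_minus)
qed

lemma dual_neq: "dual (x - \<delta>) \<noteq> dual (x + \<delta>)"
proof
  assume "dual (x - \<delta>) = dual (x + \<delta>)"
  then have "(outer (x + 2 * \<delta>) - focus) \<bullet> (dual (x - \<delta>) - focus) = 1"
    using pairing_adjacent(2)[of "x + 2 * \<delta>"] by (simp add: add.commute)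
  then have "cos (x + 2 * \<delta> - (x - \<delta>)) = cos \<delta>"
    using den_pos[of "x - \<delta>"] a cos_\<delta>_pos by (simp add: pairing)
  then show False using cos_3\<delta>_less by simp
qed

lemma polar_dual: "polar focus 1 (dual x) = {p. (cos x / a, sin x / b) \<bullet> p = 1}"
proof -
  have "(p - focus) \<bullet> (dual x - focus) = 1 \<longleftrightarrow> (cos x / a, sin x / b) \<bullet> p = 1" for p
  proof -
    obtain p1 p2 where p: "p = (p1, p2)" by (cases p)
    have "(p - focus) \<bullet> (dual x - focus) = 1 \<longleftrightarrow> (p1 + c) * cos x * b + a * sin x * p2 = b * den x"
      using den_pos[of x] b by (auto simp add: p focus_def dual_def field_simps)
    also have "\<dots> \<longleftrightarrow> b * (p1 * cos x) + a * (sin x * p2) = a * b"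
      by (auto simp: den_def algebra_simps)
    also have "\<dots> \<longleftrightarrow> (cos x / a, sin x / b) \<bullet> p = 1"
      using a b by (auto simp add: p field_simps)
    finally show ?thesis .
  qed
  then show ?thesis by (simp add: polar_def)
qed

text \<open>The right-hand side is the tangent of the inner ellipse at parameter \<open>x\<close>.
  It is the same line as in \<open>polar_dual\<close>, which identifies the pole of a side with a
  point \<open>dual x\<close>.\<close>

lemma affine_hull_outer:
  "affine hull {outer (x - \<delta>), outer (x + \<delta>)} = {p. (cos x / a, sin x / b) \<bullet> p = 1}"
proof (rule affine_hull_eq_line)
  show "(cos x / a, sin x / b) \<noteq> 0"
    using a b sin_zero_abs_cos_one[of x] by (auto simp: zero_prod_def)
  have "(cos x / a, sin x / b) \<bullet> outer y = cos (x - y) / cos \<delta>" for y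
    using a b cos_\<delta>_pos by (simp add: outer_def cos_diff field_simps)
  then show "(cos x / a, sin x / b) \<bullet> outer (x - \<delta>) = 1" "(cos x / a, sin x / b) \<bullet> outer (x + \<delta>) = 1"
    using cos_\<delta>_pos by simp_all
qed (rule outer_neq)

section \<open>Vertices, sidelines and convexity of the polar polygon\<close>

definition angle :: "nat \<Rightarrow> real" where
  "angle i = t + (2 * real i + 1) * \<delta>"

definition Q :: "point list" where
  "Q = polar_image focus 1 P"

lemma length_Q: "length Q = N"
  by (simp add: Q_def length_polar_image length_P)

lemma P_nonempty: "P \<noteq> []"
  using length_P N by auto

lemma vertex_P': "vertex P i = outer (angle i - \<delta>)" "vertex P (Suc i) = outer (angle i + \<delta>)"
proof -
  have "t + 2 * \<delta> * real i = angle i - \<delta>" "t + 2 * \<delta> * real (Suc i) = angle i + \<delta>"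
    by (simp_all add: angle_def algebra_simps)
  then show "vertex P i = outer (angle i - \<delta>)" "vertex P (Suc i) = outer (angle i + \<delta>)"
    by (simp_all only: vertex_P outer_def)
qed

lemma vertex_Q: "vertex Q i = dual (angle i)"
proof -
  have "sideline P i = polar focus 1 (dual (angle i))"
    unfolding sideline_def vertex_P'(1)[of i] vertex_P'(2)[of i] affine_hull_outer polar_dual ..
  moreover have "vertex P i \<in> sideline P i"
    by (simp add: sideline_def hull_inc)
  ultimately show ?thesis
    unfolding Q_def vertex_polar_image[OF P_nonempty]
    by (intro pole_eqI) auto
qed

text \<open>While \<open>angle i\<close> is the parameter at which side \<open>i\<close> of
  \<open>P\<close> touches the inner ellipse, \<open>mid i\<close> is the parameter of
  \<open>vertex P (Suc i)\<close>. The shift by one arises because side \<open>i\<close> of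
  \<open>Q\<close> joins the poles of sides \<open>i\<close> and \<open>Suc i\<close> of
  \<open>P\<close>, which meet at that vertex.\<close>

definition mid :: "nat \<Rightarrow> real" where
  "mid i = angle i + \<delta>"

lemma vertex_Q_mid: "vertex Q i = dual (mid i - \<delta>)" "vertex Q (Suc i) = dual (mid i + \<delta>)"
proof -
  have "angle (Suc i) = mid i + \<delta>" by (simp add: mid_def angle_def algebra_simps)
  then show "vertex Q i = dual (mid i - \<delta>)" "vertex Q (Suc i) = dual (mid i + \<delta>)"
    by (simp_all add: vertex_Q mid_def)
qed

definition nrm :: "nat \<Rightarrow> point" where
  "nrm i = outer (mid i) - focus"

lemma nrm_nonzero: "nrm i \<noteq> 0"
proof
  assume "nrm i = 0"
  then show False using pairing_adjacent(1)[of "mid i"] by (simp add: nrm_def[symmetric])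
qed

lemma sideline_Q: "sideline Q i = {x. nrm i \<bullet> x = 1 + nrm i \<bullet> focus}"
  unfolding sideline_def vertex_Q_mid(1)[of i] vertex_Q_mid(2)[of i]
proof (rule affine_hull_eq_line)
  show "nrm i \<bullet> dual (mid i - \<delta>) = 1 + nrm i \<bullet> focus" "nrm i \<bullet> dual (mid i + \<delta>) = 1 + nrm i \<bullet> focus"
    using pairing_adjacent[of "mid i"] by (simp_all add: nrm_def inner_diff_right algebra_simps)
qed (auto simp: dual_neq nrm_nonzero)

lemma sideline_Q': "sideline Q i = {x. nrm i \<bullet> (x - focus) = 1}"
  by (auto simp: sideline_Q inner_diff_right)

lemma vertex_Q_pairing:
  "nrm i \<bullet> (vertex Q j - focus)
     = 1 - a * (1 - cos ((2 * of_int (int j - int i) - 1) * \<delta>) / cos \<delta>) / den (angle j)"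
proof -
  have "mid i - angle j = - ((2 * of_int (int j - int i) - 1) * \<delta>)"
    by (simp add: mid_def angle_def algebra_simps)
  then show ?thesis by (simp only: nrm_def vertex_Q pairing cos_minus)
qed

lemma vertex_Q_less:
  assumes "i < N" "j < N" "j \<noteq> i" "j \<noteq> Suc i mod N"
  shows "nrm i \<bullet> (vertex Q j - focus) < 1"
proof -
  have "cos ((2 * of_int (int j - int i) - 1) * \<delta>) < cos \<delta>"
  proof (rule cos_odd_multiple_less)
    show "2 \<le> int j - int i \<and> int j - int i < int N \<or> 1 - int N < int j - int i \<and> int j - int i < 0"
    \<comment> \<open>The last index has successor 0, so there the excluded neighbour is the one at
      difference \<open>1 - N\<close>; for every other index it is the one at difference 1.\<close>
    proof (cases "Suc i = N")
      case True
      then show ?thesis using assms by auto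
    next
      case False
      then have "j \<noteq> Suc i" using assms by simp
      then show ?thesis using assms False by auto
    qed
  qed
  then show ?thesis using a cos_\<delta>_pos den_pos by (simp add: vertex_Q_pairing)
qed

lemma convex_polygon_Q: "convex_polygon Q"
  unfolding convex_polygon_def length_Q
proof (intro conjI allI impI)
  fix i assume i: "i < N"
  have "nrm i \<bullet> vertex Q j < 1 + nrm i \<bullet> focus" if "j < N" "j \<noteq> i" "j \<noteq> Suc i mod N" for j
    using vertex_Q_less[OF i that] by (simp add: inner_diff_right)
  moreover have "{vertex Q i, vertex Q (Suc i)} \<subseteq> sideline Q i"
    unfolding sideline_def by (rule hull_subset)
  ultimately show "\<exists>n d. n \<bullet> vertex Q i = d \<and> n \<bullet> vertex Q (Suc i) = d \<and>
      (\<forall>j<N. j \<noteq> i \<and> j \<noteq> Suc i mod N \<longrightarrow> n \<bullet> vertex Q j < d)"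
    by (intro exI[of _ "nrm i"] exI[of _ "1 + nrm i \<bullet> focus"]) (auto simp: sideline_Q)
qed (rule N)

section \<open>The circumscribed circle and the inscribed ellipse of the polar polygon\<close>

lemma set_Q: "set Q = vertex Q ` {..<N}"
  using set_eq_vertex_image[of Q] length_Q N by force

text \<open>Relative to the centre of the circle, \<open>dual x\<close> is
  \<open>a / (b\<^sup>2 * den x)\<close> times \<open>(c + a * cos x, b * sin x)\<close>. The latter
  is the vector from the focus to the point of contact on the inner ellipse, whose length is
  \<open>den x\<close>.\<close>

lemma inscribed_Q: "inscribed_in Q (sphere (- c * ((1 + b\<^sup>2) / b\<^sup>2), 0) (a / b\<^sup>2))"
proof -
  have "dual x \<in> sphere (- c * ((1 + b\<^sup>2) / b\<^sup>2), 0) (a / b\<^sup>2)" for x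
  proof -
    have "cos x / den x - c - - c * ((1 + b\<^sup>2) / b\<^sup>2) = (c * den x + b\<^sup>2 * cos x) / (b\<^sup>2 * den x)"
      using den_pos[of x] b by (simp add: field_simps)
    also have "c * den x + b\<^sup>2 * cos x = a * (c + a * cos x)"
      using c2 unfolding den_def by algebra
    finally have fst: "cos x / den x - c - - c * ((1 + b\<^sup>2) / b\<^sup>2) = a * (c + a * cos x) / (b\<^sup>2 * den x)" .
    have "dist (dual x) (- c * ((1 + b\<^sup>2) / b\<^sup>2), 0)
        = sqrt ((a * (c + a * cos x) / (b\<^sup>2 * den x))\<^sup>2 + (a * sin x / (b * den x))\<^sup>2)"
      unfolding fst[symmetric] dual_def
      by (simp only: dist_Pair_Pair dist_real_def power2_abs diff_zero)
    also have "(a * (c + a * cos x) / (b\<^sup>2 * den x))\<^sup>2 + (a * sin x / (b * den x))\<^sup>2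
        = a\<^sup>2 * ((c + a * cos x)\<^sup>2 + b\<^sup>2 * (sin x)\<^sup>2) / (b ^ 4 * (den x)\<^sup>2)"
      using den_pos[of x] b by (simp add: field_simps power2_eq_square power4_eq_xxxx)
    also have "(c + a * cos x)\<^sup>2 + b\<^sup>2 * (sin x)\<^sup>2 = (den x)\<^sup>2"
    proof -
      have "b\<^sup>2 = a\<^sup>2 - c\<^sup>2" using c2 by simp
      then show ?thesis using sin_cos_squared_add[of x] unfolding den_def by algebra
    qed
    also have "a\<^sup>2 * (den x)\<^sup>2 / (b ^ 4 * (den x)\<^sup>2) = (a / b\<^sup>2)\<^sup>2"
      using den_pos[of x] by (simp add: power_divide)
    finally show ?thesis using a by (simp add: dist_commute)
  qed
  then show ?thesis by (auto simp: inscribed_in_def set_Q vertex_Q)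
qed

text \<open>In homogeneous coordinates based at the focus, the point of contact of a side is the sum of
  the endpoints \<open>(cos x, a / b * sin x, den x)\<close>.\<close>

lemma circumscribes_Q:
  fixes k :: real
  assumes k: "0 < k" "k\<^sup>2 = a\<^sup>2 - c\<^sup>2 * (cos \<delta>)\<^sup>2"
  shows "circumscribes Q (ellipse (- (c * (a\<^sup>2 + (1 - c\<^sup>2) * (cos \<delta>)\<^sup>2) / k\<^sup>2), 0)
           (a * cos \<delta> / k\<^sup>2) (a * cos \<delta> / (b * k)))"
    (is "circumscribes Q (ellipse (?x1, 0) ?a1 ?b1)")
  unfolding circumscribes_def
proof (intro allI impI)
  fix i
  define \<theta> where "\<theta> = mid i"
  define C S \<gamma> where "C = cos \<theta>" and "S = sin \<theta>" and "\<gamma> = cos \<delta>"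
  have CS: "S\<^sup>2 + C\<^sup>2 = 1" by (simp add: C_def S_def)
  have \<gamma>: "0 < \<gamma>" using cos_\<delta>_pos by (simp add: \<gamma>_def)
  define D where "D = a + c * \<gamma> * C"
  have D: "2 * D = den (\<theta> - \<delta>) + den (\<theta> + \<delta>)"
    by (simp add: D_def den_def C_def \<gamma>_def cos_add cos_diff algebra_simps)
  have D0: "0 < D" using D den_pos[of "\<theta> - \<delta>"] den_pos[of "\<theta> + \<delta>"] by linarith
  have x1: "?x1 = - c - c * \<gamma>\<^sup>2 / k\<^sup>2"
  proof -
    have "c * (a\<^sup>2 + (1 - c\<^sup>2) * \<gamma>\<^sup>2) = c * k\<^sup>2 + c * \<gamma>\<^sup>2"
      using k(2) unfolding \<gamma>_def by algebra
    then show ?thesis using k(1) by (simp add: \<gamma>_def add_divide_distrib)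
  qed
  define u where "u q = (fst q - ?x1) / ?a1" for q :: point
  define v where "v q = snd q / ?b1" for q :: point
  have ell: "q \<in> ellipse (?x1, 0) ?a1 ?b1 \<longleftrightarrow> (u q)\<^sup>2 + (v q)\<^sup>2 = 1" for q
    by (simp add: ellipse_def u_def v_def)
  have fst_q: "fst q = - c - c * \<gamma>\<^sup>2 / k\<^sup>2 + a * \<gamma> / k\<^sup>2 * u q" for q
  proof -
    have "?a1 \<noteq> 0" using a \<gamma> k(1) by (simp add: \<gamma>_def)
    then have "fst q = ?x1 + ?a1 * u q" unfolding u_def by simp
    then show ?thesis unfolding x1 unfolding \<gamma>_def[symmetric] .
  qed
  have snd_q: "snd q = a * \<gamma> / (b * k) * v q" for q
    using a b \<gamma> k by (simp add: v_def \<gamma>_def)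
  \<comment> \<open>In the coordinates \<open>u\<close>, \<open>v\<close> the ellipse is the unit
    circle. The sideline becomes \<open>u0 * u + v0 * v = 1\<close>, the tangent of that circle at
    the unit vector \<open>(u0, v0)\<close>.\<close>
  define u0 v0 where "u0 = (a * C + c * \<gamma>) / D" and "v0 = k * S / D"
  have uv0: "u0\<^sup>2 + v0\<^sup>2 = 1"
  proof -
    have "(a * C + c * \<gamma>)\<^sup>2 + k\<^sup>2 * S\<^sup>2 = D\<^sup>2"
      using CS k(2) unfolding D_def \<gamma>_def[symmetric] by algebra
    then show ?thesis using D0 by (simp add: u0_def v0_def power_divide power_mult_distrib flip: add_divide_distrib)
  qed
  have line: "nrm i \<bullet> (q - focus) = 1 \<longleftrightarrow> u0 * u q + v0 * v q = 1" for q
  proof -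
    have "nrm i \<bullet> (q - focus) = (a * C / \<gamma> + c) * (fst q + c) + b * S / \<gamma> * snd q"
      by (cases q) (simp add: nrm_def outer_def focus_def \<theta>_def[symmetric] C_def S_def \<gamma>_def)
    also have "\<dots> = ((a * C + c * \<gamma>) * (a * u q - c * \<gamma>) + a * k * S * v q) / k\<^sup>2"
      unfolding fst_q snd_q using \<gamma> k(1) b by (simp add: field_simps power2_eq_square)
    also have "(a * C + c * \<gamma>) * (a * u q - c * \<gamma>) + a * k * S * v q
        = k\<^sup>2 + a * ((a * C + c * \<gamma>) * u q + k * S * v q - D)"
      using k(2) unfolding D_def \<gamma>_def[symmetric] by algebra
    also have "(a * C + c * \<gamma>) * u q + k * S * v q - D = D * (u0 * u q + v0 * v q - 1)"
      using D0 by (simp add: u0_def v0_def field_simps)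
    finally have "nrm i \<bullet> (q - focus) = 1 + a * (D * (u0 * u q + v0 * v q - 1)) / k\<^sup>2"
      using k(1) by (simp add: add_divide_distrib)
    then show ?thesis using k(1) a D0 by simp
  qed
  \<comment> \<open>Dividing the sum of the homogeneous coordinates by its last entry
    \<open>2 * D\<close> turns it into a convex combination of the two vertices, so the point of
    contact lies on the side itself.\<close>
  define w1 w2 where "w1 = den (\<theta> - \<delta>) / (2 * D)" and "w2 = den (\<theta> + \<delta>) / (2 * D)"
  define T where "T = w1 *\<^sub>R vertex Q i + w2 *\<^sub>R vertex Q (Suc i)"
  have w: "0 \<le> w1" "0 \<le> w2" "w1 + w2 = 1"
    using D0 den_pos[of "\<theta> - \<delta>"] den_pos[of "\<theta> + \<delta>"] D
    by (simp_all add: w1_def w2_def flip: add_divide_distrib)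
  have "w1 = 1 - w2" "w2 \<le> 1" using w by linarith+
  then have T_side: "T \<in> side Q i"
    unfolding side_def closed_segment_def T_def using w(2) by blast
  then have T_line: "T \<in> sideline Q i"
    using convex_hull_subset_affine_hull[of "{vertex Q i, vertex Q (Suc i)}"]
    by (auto simp: side_def sideline_def segment_convex_hull)
  have "snd T = a / b * \<gamma> * S / D"
  proof -
    have "snd T = (a * sin (\<theta> - \<delta>) + a * sin (\<theta> + \<delta>)) / (2 * D * b)"
      using den_pos[of "\<theta> - \<delta>"] den_pos[of "\<theta> + \<delta>"] D0 b
      by (simp add: T_def vertex_Q_mid(1)[of i] vertex_Q_mid(2)[of i] \<theta>_def[symmetric] dual_def w1_def w2_def field_simps)
    also have "a * sin (\<theta> - \<delta>) + a * sin (\<theta> + \<delta>) = 2 * (a * \<gamma> * S)"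
      by (simp add: sin_add sin_diff S_def \<gamma>_def algebra_simps)
    finally show ?thesis using D0 b by (simp add: field_simps)
  qed
  then have vT: "v T = v0"
    using a b \<gamma> k(1) D0 by (simp add: v_def v0_def \<gamma>_def field_simps)
  have "fst T = \<gamma> * C / D - c"
  proof -
    have "fst T = w1 * (cos (\<theta> - \<delta>) / den (\<theta> - \<delta>)) + w2 * (cos (\<theta> + \<delta>) / den (\<theta> + \<delta>)) - (w1 + w2) * c"
      by (simp add: T_def vertex_Q_mid(1)[of i] vertex_Q_mid(2)[of i] \<theta>_def[symmetric] dual_def algebra_simps)
    also have "\<dots> = (cos (\<theta> - \<delta>) + cos (\<theta> + \<delta>)) / (2 * D) - c"
      using den_pos[of "\<theta> - \<delta>"] den_pos[of "\<theta> + \<delta>"] D0 w(3)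
      by (simp add: w1_def w2_def add_divide_distrib)
    finally show ?thesis by (simp add: cos_add cos_diff C_def \<gamma>_def)
  qed
  then have "u T = (\<gamma> * C / D + c * \<gamma>\<^sup>2 / k\<^sup>2) / (a * \<gamma> / k\<^sup>2)"
    unfolding u_def x1 by (simp add: \<gamma>_def)
  also have "\<dots> = (k\<^sup>2 * C + c * \<gamma> * D) / (a * D)"
    using a \<gamma> k(1) D0 by (simp add: field_simps power2_eq_square)
  also have "k\<^sup>2 * C + c * \<gamma> * D = a * (a * C + c * \<gamma>)"
    using k(2) unfolding D_def \<gamma>_def[symmetric] by algebra
  finally have uT: "u T = u0" using a by (simp add: u0_def)
  have "q = T" if q: "q \<in> sideline Q i" "q \<in> ellipse (?x1, 0) ?a1 ?b1" for q
  proof -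
    have "(u q - u0)\<^sup>2 + (v q - v0)\<^sup>2 = (u q)\<^sup>2 + (v q)\<^sup>2 + (u0\<^sup>2 + v0\<^sup>2) - 2 * (u0 * u q + v0 * v q)"
      by (simp add: power2_eq_square algebra_simps)
    then have "(u q - u0)\<^sup>2 + (v q - v0)\<^sup>2 = 0"
      using q uv0 by (simp add: ell sideline_Q' line)
    then have "u q = u T" "v q = v T" by (simp_all add: sum_power2_eq_zero_iff uT vT)
    then show "q = T" using fst_q[of q] fst_q[of T] snd_q[of q] snd_q[of T] by (simp add: prod_eq_iff)
  qed
  moreover have "T \<in> ellipse (?x1, 0) ?a1 ?b1" using uv0 by (simp add: ell uT vT)
  ultimately show "side_tangent Q i (ellipse (?x1, 0) ?a1 ?b1)"
    unfolding side_tangent_def using T_side T_line by blast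
qed

section \<open>Side lengths and the symmedian point\<close>

lemma infdist_sideline_Q: "infdist K (sideline Q i) = \<bar>1 - nrm i \<bullet> (K - focus)\<bar> / norm (nrm i)"
  using infdist_hyperplane[OF nrm_nonzero[of i], of K]
  by (simp add: sideline_Q inner_diff_right algebra_simps)

text \<open>Both endpoints, taken relative to the focus, have inner product 1 with
  \<open>nrm i\<close>. Their difference is therefore their determinant \<open>\<mu>\<close> times
  \<open>nrm i\<close> turned by a right angle. The determinant is a constant over the product
  \<open>D\<close> of the two denominators, and \<open>D\<close> is a constant times the squared
  norm of \<open>nrm i\<close>.\<close>

lemma dist_vertex_Q:
  "dist (vertex Q i) (vertex Q (Suc i)) = 2 * a * \<bar>sin \<delta>\<bar> / (b * cos \<delta>) / norm (nrm i)"
proof -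
  define \<theta> where "\<theta> = mid i"
  define D where "D = den (\<theta> - \<delta>) * den (\<theta> + \<delta>)"
  obtain n1 n2 where n: "nrm i = (n1, n2)" by (cases "nrm i")
  obtain p1 p2 where p: "dual (\<theta> - \<delta>) - focus = (p1, p2)" by (cases "dual (\<theta> - \<delta>) - focus")
  obtain q1 q2 where q: "dual (\<theta> + \<delta>) - focus = (q1, q2)" by (cases "dual (\<theta> + \<delta>) - focus")
  define \<mu> where "\<mu> = p1 * q2 - p2 * q1"
  have np: "n1 * p1 + n2 * p2 = 1" and nq: "n1 * q1 + n2 * q2 = 1"
    using pairing_adjacent[of "mid i"]
    unfolding nrm_def[symmetric] n p[unfolded \<theta>_def] q[unfolded \<theta>_def] by simp_all
  have 1: "p1 - q1 = \<mu> * n2" "p2 - q2 = - \<mu> * n1"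
    using np nq unfolding \<mu>_def by algebra+
  have "dual (\<theta> - \<delta>) - dual (\<theta> + \<delta>) = (p1 - q1, p2 - q2)"
    using p q by (metis diff_Pair diff_diff_eq2 diff_add_cancel)
  then have "dist (vertex Q i) (vertex Q (Suc i)) = sqrt ((\<mu> * n2)\<^sup>2 + (- \<mu> * n1)\<^sup>2)"
    unfolding vertex_Q_mid(1)[of i] vertex_Q_mid(2)[of i] \<theta>_def[symmetric] dist_norm by (simp add: norm_Pair 1)
  also have "(\<mu> * n2)\<^sup>2 + (- \<mu> * n1)\<^sup>2 = \<mu>\<^sup>2 * (n1\<^sup>2 + n2\<^sup>2)"
    by (simp add: power_mult_distrib algebra_simps)
  also have "sqrt \<dots> = \<bar>\<mu>\<bar> * norm (nrm i)"
    by (simp add: n norm_Pair real_sqrt_mult)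
  finally have dist: "dist (vertex Q i) (vertex Q (Suc i)) = \<bar>\<mu>\<bar> * norm (nrm i)" .
  have "\<mu> = a / b * (sin (\<theta> + \<delta>) * cos (\<theta> - \<delta>) - cos (\<theta> + \<delta>) * sin (\<theta> - \<delta>)) / D"
  proof -
    have pq: "p1 = cos (\<theta> - \<delta>) / den (\<theta> - \<delta>)" "p2 = a * sin (\<theta> - \<delta>) / (b * den (\<theta> - \<delta>))"
      "q1 = cos (\<theta> + \<delta>) / den (\<theta> + \<delta>)" "q2 = a * sin (\<theta> + \<delta>) / (b * den (\<theta> + \<delta>))"
      using p q by (simp_all add: dual_def focus_def)
    show ?thesis
      unfolding \<mu>_def D_def pq using den_pos[of "\<theta> - \<delta>"] den_pos[of "\<theta> + \<delta>"] b
      by (simp add: field_simps)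
  qed
  also have "sin (\<theta> + \<delta>) * cos (\<theta> - \<delta>) - cos (\<theta> + \<delta>) * sin (\<theta> - \<delta>) = 2 * sin \<delta> * cos \<delta>"
    using sin_diff[of "\<theta> + \<delta>" "\<theta> - \<delta>"] sin_double[of \<delta>] by simp
  finally have \<mu>: "\<mu> = a / b * (2 * sin \<delta> * cos \<delta>) / D" .
  have D: "(cos \<delta>)\<^sup>2 * (norm (nrm i))\<^sup>2 = D"
  proof -
    have "(norm (nrm i))\<^sup>2 = (a / cos \<delta> * cos \<theta> + c)\<^sup>2 + (b / cos \<delta> * sin \<theta>)\<^sup>2"
      unfolding power2_norm_eq_inner
      by (simp add: nrm_def outer_def focus_def \<theta>_def[symmetric] power2_eq_square)
    then have "(cos \<delta>)\<^sup>2 * (norm (nrm i))\<^sup>2 = (a * cos \<theta> + c * cos \<delta>)\<^sup>2 + b\<^sup>2 * (sin \<theta>)\<^sup>2"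
      using cos_\<delta>_pos by (simp add: field_simps power2_eq_square)
    moreover have "b\<^sup>2 = a\<^sup>2 - c\<^sup>2" using c2 by simp
    ultimately show ?thesis
      using sin_cos_squared_add[of \<theta>] sin_cos_squared_add[of \<delta>]
      unfolding D_def den_def cos_add cos_diff by algebra
  qed
  have "0 < D" using den_pos by (simp add: D_def)
  then have "\<bar>\<mu>\<bar> = a / b * (2 * \<bar>sin \<delta>\<bar> * cos \<delta>) / D"
    using a b cos_\<delta>_pos by (simp add: \<mu> abs_mult)
  then show ?thesis
    using dist cos_\<delta>_pos nrm_nonzero[of i] b unfolding D[symmetric]
    by (simp add: field_simps power2_eq_square)
qed

text \<open>Weighted by the positive numbers \<open>den (angle i)\<close>, the vertices relative to
  the focus become equally spaced points of an ellipse and sum to zero. A direction in which none of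
  them is positive is thus orthogonal to all of them, and two consecutive ones are linearly
  independent.\<close>

lemma focus_interior: "focus \<in> interior (convex hull set Q)"
proof (rule in_interior_convex_hullI, rule ccontr)
  fix w :: point
  assume w: "w \<noteq> 0" and "\<not> (\<exists>x\<in>set Q. w \<bullet> focus < w \<bullet> x)"
  then have le: "w \<bullet> (vertex Q i - focus) \<le> 0" if "i < N" for i
    using that by (auto simp: set_Q inner_diff_right not_less)
  obtain w1 w2 where w12: "w = (w1, w2)" by (cases w)
  define v where "v = w2 * a / b"
  define g where "g i = w1 * cos (angle i) + v * sin (angle i)" for i
  have "w \<bullet> (vertex Q i - focus) = g i / den (angle i)" for i
    using den_pos[of "angle i"] b
    by (simp add: w12 vertex_Q dual_def focus_def g_def v_def field_simps)
  then have g: "g i \<le> 0" if "i < N" for i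
    using le[OF that] den_pos[of "angle i"] by (simp add: divide_le_0_iff)
  \<comment> \<open>\<open>F\<close> is a discrete antiderivative of \<open>g\<close> up to the
    factor \<open>2 * sin \<delta>\<close>. Since it returns to its initial value after a full turn,
    the sum of \<open>g\<close> telescopes to zero.\<close>
  define F where "F i = w1 * sin (t + 2 * \<delta> * real i) - v * cos (t + 2 * \<delta> * real i)" for i
  have F_diff: "F (Suc i) - F i = 2 * sin \<delta> * g i" for i
  proof -
    have "t + 2 * \<delta> * real (Suc i) = angle i + \<delta>" "t + 2 * \<delta> * real i = angle i - \<delta>"
      by (simp_all add: angle_def algebra_simps)
    then have "F (Suc i) - F i = w1 * sin (angle i + \<delta>) - v * cos (angle i + \<delta>)
        - (w1 * sin (angle i - \<delta>) - v * cos (angle i - \<delta>))"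
      by (simp only: F_def)
    then show ?thesis
      by (simp add: g_def sin_add sin_diff cos_add cos_diff algebra_simps)
  qed
  have "2 * sin \<delta> * (\<Sum>i<N. g i) = F N - F 0"
    using sum_lessThan_telescope[of F N] by (simp add: F_diff sum_distrib_left)
  also have "F N = F 0"
    using full_turn by (simp add: F_def cos_add sin_add)
  finally have "(\<Sum>i<N. g i) = 0" using sin_\<delta>_nonzero by simp
  then have "(\<Sum>i<N. - g i) = 0" by (simp add: sum_negf)
  then have g0: "g i = 0" if "i < N" for i
    using sum_nonneg_eq_0_iff[of "{..<N}" "\<lambda>i. - g i"] g that by auto
  have "angle 0 = mid 0 - \<delta>" "angle 1 = mid 0 + \<delta>"
    by (simp_all add: mid_def angle_def)
  then have "w1 * cos (mid 0 - \<delta>) + v * sin (mid 0 - \<delta>) = 0"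
    "w1 * cos (mid 0 + \<delta>) + v * sin (mid 0 + \<delta>) = 0"
    using g0[of 0] g0[of 1] N unfolding g_def by simp_all
  then have "w1 = 0" "v = 0"
    by (rule unit_vectors_orthogonal_imp_zero; use cos_\<delta>_pos sin_\<delta>_nonzero in simp)+
  then show False using w w12 a b by (auto simp: v_def zero_prod_def)
qed

lemma symmedian_focus: "is_symmedian_point Q focus"
  unfolding is_symmedian_point_def
proof (intro conjI exI allI impI)
  fix i
  show "infdist focus (sideline Q i)
      = b * cos \<delta> / (2 * a * \<bar>sin \<delta>\<bar>) * dist (vertex Q i) (vertex Q (Suc i))"
    using a b cos_\<delta>_pos sin_\<delta>_nonzero nrm_nonzero[of i]
    by (simp add: infdist_sideline_Q dist_vertex_Q)
qed (rule focus_interior)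

text \<open>This fixes the sign inside the absolute value of \<open>infdist_sideline_Q\<close>, so
  that proportional distances become linear equations for \<open>K\<close>.\<close>

lemma hull_Q_halfplane:
  assumes "i < N" "K \<in> convex hull set Q"
  shows "nrm i \<bullet> (K - focus) \<le> 1"
proof -
  have "vertex Q j \<in> {x. nrm i \<bullet> x \<le> 1 + nrm i \<bullet> focus}" if "j < N" for j
  proof (cases "j = i \<or> j = Suc i mod N")
    case True
    then have "vertex Q j \<in> {vertex Q i, vertex Q (Suc i)}"
      using vertex_mod[of Q "Suc i"] by (auto simp: length_Q)
    then have "vertex Q j \<in> sideline Q i" unfolding sideline_def by (rule hull_inc)
    then show ?thesis by (simp add: sideline_Q)
  next
    case False
    then show ?thesis
      using vertex_Q_less[OF assms(1) that] by (simp add: inner_diff_right)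
  qed
  then have "convex hull set Q \<subseteq> {x. nrm i \<bullet> x \<le> 1 + nrm i \<bullet> focus}"
    by (intro hull_minimal convex_halfspace_le) (auto simp: set_Q)
  then show ?thesis using assms(2) by (auto simp: inner_diff_right)
qed

text \<open>If a point has distances to the sidelines proportional to those of the focus, then
  \<open>nrm i \<bullet> (K - focus)\<close> does not depend on \<open>i\<close>; three consecutive sides suffice.\<close>

lemma symmedian_unique:
  assumes "is_symmedian_point Q K"
  shows "K = focus"
proof -
  have hull: "K \<in> convex hull set Q"
    using assms interior_subset by (auto simp: is_symmedian_point_def)
  obtain \<kappa> where \<kappa>: "infdist K (sideline Q i) = \<kappa> * dist (vertex Q i) (vertex Q (Suc i))" if "i < N" for i
    using assms by (auto simp: is_symmedian_point_def length_Q)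
  have const: "nrm i \<bullet> (K - focus) = 1 - \<kappa> * (2 * a * \<bar>sin \<delta>\<bar> / (b * cos \<delta>))" if "i < N" for i
  proof -
    have "(1 - nrm i \<bullet> (K - focus)) / norm (nrm i)
        = \<kappa> * (2 * a * \<bar>sin \<delta>\<bar> / (b * cos \<delta>)) / norm (nrm i)"
      using \<kappa>[OF that] hull_Q_halfplane[OF that hull]
      by (simp add: infdist_sideline_Q dist_vertex_Q)
    then have "1 - nrm i \<bullet> (K - focus) = \<kappa> * (2 * a * \<bar>sin \<delta>\<bar> / (b * cos \<delta>))"
      using nrm_nonzero[of i] by (subst (asm) divide_cancel_right) simp
    then show ?thesis by linarith
  qed
  obtain p q where pq: "K - focus = (p, q)" by (cases "K - focus")
  define u v where "u = a / cos \<delta> * p" and "v = b / cos \<delta> * q"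
  have diff: "u * cos (mid i) + v * sin (mid i) = u * cos (mid j) + v * sin (mid j)" if "i < N" "j < N" for i j
  proof -
    have "nrm l \<bullet> (K - focus) = u * cos (mid l) + v * sin (mid l) + c * p" for l
      unfolding pq by (simp add: nrm_def outer_def focus_def u_def v_def algebra_simps)
    then show ?thesis using const[OF that(1)] const[OF that(2)] by simp
  qed
  define x where "x = mid 1"
  have m: "mid 0 = x - 2 * \<delta>" "mid 2 = x + 2 * \<delta>"
    by (simp_all add: x_def mid_def angle_def algebra_simps)
  have d: "u * cos (x - 2 * \<delta>) + v * sin (x - 2 * \<delta>) = u * cos x + v * sin x"
    "u * cos (x + 2 * \<delta>) + v * sin (x + 2 * \<delta>) = u * cos x + v * sin x"
    using diff[of 0 1] diff[of 2 1] N unfolding m x_def[symmetric] by simp_all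
  \<comment> \<open>Half the difference and half the sum of the two equations in
    \<open>d\<close>.\<close>
  have "sin (2 * \<delta>) * (v * cos x - u * sin x) = 0"
    "(1 - cos (2 * \<delta>)) * (u * cos x + v * sin x) = 0"
    using d unfolding cos_add cos_diff sin_add sin_diff by algebra+
  moreover have "1 - cos (2 * \<delta>) \<noteq> 0" using sin_\<delta>_nonzero by (simp add: cos_double_sin)
  ultimately have *: "v * cos x - u * sin x = 0" "u * cos x + v * sin x = 0"
    using sin_2\<delta>_nonzero by auto
  have "u * ((sin x)\<^sup>2 + (cos x)\<^sup>2) = 0" "v * ((sin x)\<^sup>2 + (cos x)\<^sup>2) = 0"
    using * by algebra+
  then have "p = 0" "q = 0" using a b cos_\<delta>_pos by (simp_all add: u_def v_def)
  then have "K - focus = 0" using pq by (simp add: zero_prod_def)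
  then show ?thesis by simp
qed

lemma harmonic_Q: "harmonic_polygon Q"
  using convex_polygon_Q inscribed_Q symmedian_focus unfolding harmonic_polygon_def by blast

end

section \<open>Members of the Poncelet family are affinely regular\<close>

definition ellipse_point :: "real \<Rightarrow> real \<Rightarrow> real \<Rightarrow> point" where
  "ellipse_point a b x = (a * cos x, b * sin x)"

lemma ellipse_point_inject:
  assumes "a \<noteq> 0" "b \<noteq> 0"
  shows "ellipse_point a b x = ellipse_point a b y \<longleftrightarrow> cos x = cos y \<and> sin x = sin y"
  using assms by (simp add: ellipse_point_def)

lemma in_ellipse_point:
  assumes "p \<in> ellipse (0, 0) a b" "a \<noteq> 0" "b \<noteq> 0"
  obtains x where "p = ellipse_point a b x"
proof -
  have "(fst p / a)\<^sup>2 + (snd p / b)\<^sup>2 = 1" using assms(1) by (simp add: ellipse_def)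
  then obtain x where "fst p / a = cos x" "snd p / b = sin x" by (rule sincos_total_2pi)
  then have "p = ellipse_point a b x"
    using assms(2,3) by (simp add: ellipse_point_def prod_eq_iff field_simps)
  then show thesis by (rule that)
qed

lemma cos_eq_cosD:
  fixes x y :: real
  assumes "cos x = cos y"
  obtains n :: int where "x = y + 2 * pi * n" | n :: int where "x = - y + 2 * pi * n"
proof -
  have "(sin x)\<^sup>2 = (sin y)\<^sup>2" using assms by (simp add: sin_squared_eq)
  then have "sin x = sin y \<or> sin x = sin (- y)" by (simp add: power2_eq_iff)
  then show thesis
    using sin_cos_eq_iff[of x y] sin_cos_eq_iff[of x "- y"] assms that by auto
qed

text \<open>A single common point forces the chord to lie on the tangent at \<open>T\<close>, which
  the outer ellipse meets exactly where the parameter differs from that of \<open>T\<close> by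
  \<open>\<beta>\<close> in cosine. Two distinct such points lie on opposite sides of
  \<open>T\<close>, hence \<open>2 * \<beta>\<close> apart.\<close>

lemma tangent_chord_step:
  fixes a b \<beta> \<theta> :: real
  defines "E \<equiv> ellipse_point (a / cos \<beta>) (b / cos \<beta>)"
  assumes a: "0 < a" and b: "0 < b" and \<beta>: "0 < cos \<beta>"
    and q: "q \<in> ellipse (0, 0) (a / cos \<beta>) (b / cos \<beta>)" and ne: "E \<theta> \<noteq> q"
    and tangent: "affine hull {E \<theta>, q} \<inter> ellipse (0, 0) a b = {T}"
  shows "q = E (\<theta> + 2 * \<beta>) \<or> q = E (\<theta> - 2 * \<beta>)"
proof -
  obtain \<eta> where \<eta>: "q = E \<eta>"
    using in_ellipse_point[OF q] a b \<beta> unfolding E_def by auto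
  have "T \<in> ellipse (0, 0) a b" using tangent by blast
  then obtain \<phi> where \<phi>: "T = ellipse_point a b \<phi>"
    using in_ellipse_point a b by (metis less_irrefl)
  define n where "n = (cos \<phi> / a, sin \<phi> / b)"
  have nE: "n \<bullet> E x = cos (x - \<phi>) / cos \<beta>" for x
    using a b \<beta> by (simp add: n_def E_def ellipse_point_def cos_diff field_simps)
  have nT: "n \<bullet> T = 1"
    using a b sin_cos_squared_add2[of \<phi>]
    by (simp add: n_def \<phi> ellipse_point_def power2_eq_square)
  define d where "d = q - E \<theta>"
  have "T \<in> affine hull {E \<theta>, q}" using tangent by blast
  then obtain u v where uv: "u + v = 1" "T = u *\<^sub>R E \<theta> + v *\<^sub>R q" unfolding affine_hull_2 by blast
  have u: "u = 1 - v" using uv(1) by simp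
  have T: "T = E \<theta> + v *\<^sub>R d" unfolding uv(2) d_def u by (simp add: algebra_simps)
  have nd: "n \<bullet> d = 0"
  proof -
    obtain d1 d2 where d12: "d = (d1, d2)" by (cases d)
    define B where "B = (d1 / a)\<^sup>2 + (d2 / b)\<^sup>2"
    have "d \<noteq> 0" using ne by (simp add: d_def)
    then have B: "B > 0" using a b unfolding B_def d12
      by (auto simp: zero_prod_def sum_power2_gt_zero_iff)
    \<comment> \<open>On the line \<open>T + s *\<^sub>R d\<close> the quadratic form of the inner
      ellipse takes the value \<open>1 + s * (2 * (n \<bullet> d) + s * B)\<close>. This
      \<open>s\<close> makes the bracket vanish, so it gives another common point unless
      \<open>n \<bullet> d = 0\<close>.\<close>
    define s where "s = - 2 * (n \<bullet> d) / B"
    have sB: "s * B = - 2 * (n \<bullet> d)" using B by (simp add: s_def)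
    have "T + s *\<^sub>R d = (1 - (v + s)) *\<^sub>R E \<theta> + (v + s) *\<^sub>R q"
      unfolding T d_def by (simp add: algebra_simps)
    then have hull: "T + s *\<^sub>R d \<in> affine hull {E \<theta>, q}"
      unfolding affine_hull_2 by force
    have "((a * cos \<phi> + s * d1) / a)\<^sup>2 + ((b * sin \<phi> + s * d2) / b)\<^sup>2
        = (cos \<phi> + s * (d1 / a))\<^sup>2 + (sin \<phi> + s * (d2 / b))\<^sup>2"
      using a b by (simp add: add_divide_distrib)
    also have "\<dots> = ((sin \<phi>)\<^sup>2 + (cos \<phi>)\<^sup>2) + s * (2 * (n \<bullet> d) + s * B)"
      by (simp add: n_def d12 B_def power2_eq_square algebra_simps)
    also have "\<dots> = 1" by (simp add: sB)
    finally have "T + s *\<^sub>R d \<in> ellipse (0, 0) a b"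
      by (simp add: ellipse_def \<phi> ellipse_point_def d12)
    then have "T + s *\<^sub>R d = T" using hull tangent by blast
    then show ?thesis using \<open>d \<noteq> 0\<close> sB by auto
  qed
  have "n \<bullet> E \<theta> = 1" using nT nd by (simp add: T inner_add_right)
  moreover have "n \<bullet> E \<eta> = 1"
    using calculation nd by (simp add: d_def \<eta> inner_diff_right)
  ultimately have cos: "cos (\<theta> - \<phi>) = cos \<beta>" "cos (\<eta> - \<phi>) = cos \<beta>"
    using \<beta> by (simp_all add: nE)
  have shift: "E (x + 2 * pi * of_int n) = E x" for x and n :: int
    by (simp add: E_def ellipse_point_def cos_sin_add_2pi_int)
  have E_\<eta>: "E \<eta> = E (\<theta> + x)" if "\<eta> - \<phi> = y + 2 * pi * of_int l" "\<theta> - \<phi> = z + 2 * pi * of_int n" "x = y - z"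
    for x y z and l n :: int
  proof -
    have "\<eta> = (\<theta> + x) + 2 * pi * of_int (l - n)" using that by (simp add: algebra_simps)
    then show ?thesis using shift by metis
  qed
  \<comment> \<open>Equal signs would make the endpoints coincide, against \<open>ne\<close>;
    opposite signs give the two alternatives.\<close>
  from cos(1) show ?thesis
  proof (cases rule: cos_eq_cosD)
    case (1 n)
    from cos(2) show ?thesis
    proof (cases rule: cos_eq_cosD)
      case (1 l)
      then show ?thesis using E_\<eta>[OF 1 \<open>\<theta> - \<phi> = \<beta> + 2 * pi * of_int n\<close>, of 0] ne \<eta> by simp
    next
      case (2 l)
      then show ?thesis using E_\<eta>[OF 2 1, of "- 2 * \<beta>"] \<eta> by simp
    qed
  next
    case (2 n)
    from cos(2) show ?thesis
    proof (cases rule: cos_eq_cosD)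
      case (1 l)
      then show ?thesis using E_\<eta>[OF 1 2, of "2 * \<beta>"] \<eta> by simp
    next
      case (2 l)
      then show ?thesis using E_\<eta>[OF 2 \<open>\<theta> - \<phi> = - \<beta> + 2 * pi * of_int n\<close>, of 0] ne \<eta> by simp
    qed
  qed
qed

text \<open>The strict half-plane of side \<open>i\<close> separates vertex \<open>i\<close> from
  all vertices but its successor. For that remaining pair the side starting at the successor does
  it, since with at least three vertices \<open>i\<close> is not an endpoint of that side.\<close>

lemma convex_polygon_vertex_neq:
  assumes P: "convex_polygon P" and ij: "i mod length P \<noteq> j mod length P"
  shows "vertex P i \<noteq> vertex P j"
proof -
  define N where "N = length P"
  have N: "3 \<le> N" using P by (simp add: convex_polygon_def N_def)
  have *: "vertex P i \<noteq> vertex P j" if "i < N" "j < N" "j \<noteq> i" "j \<noteq> Suc i mod N" for i j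
    using P that unfolding convex_polygon_def N_def by (metis less_irrefl)
  define i' j' where "i' = i mod N" and "j' = j mod N"
  have "0 < N" using N by simp
  then have ij': "i' < N" "j' < N" "i' \<noteq> j'" using ij by (simp_all add: i'_def j'_def N_def)
  have "vertex P i' \<noteq> vertex P j'"
  proof (cases "j' = Suc i' mod N")
    case True
    then have "i' \<noteq> Suc j' mod N" using ij' N by (auto simp: mod_Suc split: if_splits)
    then show ?thesis using *[of j' i'] ij' by auto
  next
    case False
    then show ?thesis using *[of i' j'] ij' by auto
  qed
  then show ?thesis by (simp add: i'_def j'_def N_def vertex_mod)
qed

text \<open>The first vertex \<open>j\<close> past a full turn lies in the arc from vertex \<open>0\<close> to vertex \<open>1\<close>, which
  the hypothesis on the cosines forbids unless \<open>j = N\<close>.\<close>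

lemma cos_odd_multiples_less_imp_one_turn:
  fixes \<beta> :: real and k :: int
  assumes \<beta>: "0 < \<beta>" "\<beta> < pi / 2" and k: "real N * \<beta> = pi * of_int k"
    and less: "\<And>j. 2 \<le> j \<Longrightarrow> j < N \<Longrightarrow> cos ((2 * real j - 1) * \<beta>) < cos \<beta>" and N: "0 < N"
  shows "real N * \<beta> = pi"
proof -
  have "0 < pi * of_int k" using k \<beta> N by (metis mult_pos_pos of_nat_0_less_iff)
  then have k1: "1 \<le> k" by (simp add: zero_less_mult_iff)
  then have "pi * 1 \<le> pi * of_int k" by (intro mult_left_mono) auto
  then have piN: "pi \<le> real N * \<beta>" using k by simp
  define j where "j = (LEAST j. pi \<le> real j * \<beta>)"
  have j: "pi \<le> real j * \<beta>" unfolding j_def by (rule LeastI[of _ N]) (rule piN)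
  have jN: "j \<le> N" unfolding j_def by (rule Least_le) (rule piN)
  have j0: "j \<noteq> 0" using j pi_gt_zero by (intro notI) simp
  have "\<not> pi \<le> real (j - 1) * \<beta>"
    using not_less_Least[of "j - 1" "\<lambda>j. pi \<le> real j * \<beta>"] j0 unfolding j_def[symmetric] by simp
  then have j': "(real j - 1) * \<beta> < pi" using j0 by (simp add: of_nat_diff)
  have "j = N"
  proof (rule ccontr)
    assume "j \<noteq> N"
    then have "j < N" using jN by simp
    have "2 < real j"
    proof (rule ccontr)
      assume "\<not> 2 < real j"
      then have "real j * \<beta> \<le> 2 * \<beta>" using \<beta> by (intro mult_right_mono) auto
      then show False using j \<beta> by linarith
    qed
    then have "cos ((2 * real j - 1) * \<beta>) < cos \<beta>" using less[of j] \<open>j < N\<close> by simp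
    moreover have "cos ((2 * real j - 1) * \<beta>) = cos \<bar>(2 * real j - 1) * \<beta> - 2 * pi\<bar>"
      by (simp add: cos_diff)
    \<comment> \<open>The two bounds are twice \<open>pi \<le> real j * \<beta>\<close> and twice
      the minimality of \<open>j\<close>.\<close>
    moreover have "\<bar>(2 * real j - 1) * \<beta> - 2 * pi\<bar> \<le> \<beta>"
      using j j' by (simp add: abs_le_iff algebra_simps)
    then have "cos \<beta> \<le> cos \<bar>(2 * real j - 1) * \<beta> - 2 * pi\<bar>"
      using \<beta> by (intro cos_monotone_0_pi_le) auto
    ultimately show False by simp
  qed
  \<comment> \<open>Minimality at \<open>j = N\<close> keeps \<open>real N * \<beta>\<close> below
    \<open>2 * pi\<close>, so \<open>pi\<close> is the only multiple left.\<close>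
  then have N\<beta>: "real N * \<beta> < pi + \<beta>" using j' by (simp add: algebra_simps)
  have "k = 1"
  proof (rule ccontr)
    assume "k \<noteq> 1"
    then have "(2::real) \<le> of_int k" using k1 by linarith
    then have "pi * 2 \<le> pi * of_int k" by (intro mult_left_mono) auto
    then show False using k N\<beta> \<beta> by linarith
  qed
  then show ?thesis using k by simp
qed

lemma poncelet_family_vertices:
  fixes a b \<beta> :: real
  assumes a: "0 < a" and b: "0 < b" and \<beta>: "0 < \<beta>" "\<beta> < pi / 2"
    and P: "P \<in> poncelet_family N (ellipse (0, 0) (a / cos \<beta>) (b / cos \<beta>)) (ellipse (0, 0) a b)"
  obtains \<delta> t where "\<bar>\<delta>\<bar> = \<beta>" "real N * \<beta> = pi"
    "\<And>i. vertex P i = ellipse_point (a / cos \<beta>) (b / cos \<beta>) (t + 2 * \<delta> * real i)"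
proof -
  define E where "E = ellipse_point (a / cos \<beta>) (b / cos \<beta>)"
  have c\<beta>: "0 < cos \<beta>" using \<beta> by (intro cos_gt_zero) auto
  have len: "length P = N" and conv: "convex_polygon P"
    and ins: "set P \<subseteq> ellipse (0, 0) (a / cos \<beta>) (b / cos \<beta>)"
    and circ: "circumscribes P (ellipse (0, 0) a b)"
    using P by (auto simp: poncelet_family_def interscribed_def inscribed_in_def)
  have N: "3 \<le> N" using conv len by (simp add: convex_polygon_def)
  have inE: "vertex P i \<in> ellipse (0, 0) (a / cos \<beta>) (b / cos \<beta>)" for i
  proof -
    have "i mod length P < length P" using len N by (intro mod_less_divisor) linarith
    then show ?thesis using ins nth_mem by (auto simp: vertex_def)
  qed
  have ne1: "vertex P i \<noteq> vertex P (Suc i)" for i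
    using N by (intro convex_polygon_vertex_neq conv) (simp add: len mod_Suc)
  have ne2: "vertex P i \<noteq> vertex P (Suc (Suc i))" for i
    using N by (intro convex_polygon_vertex_neq conv) (simp add: len mod_Suc)
  have step: "vertex P (Suc i) = E (x + 2 * \<beta>) \<or> vertex P (Suc i) = E (x - 2 * \<beta>)"
    if "vertex P i = E x" for i x
  proof -
    have "i mod N < N" using N by simp
    then obtain T where "sideline P (i mod N) \<inter> ellipse (0, 0) a b = {T}"
      using circ by (auto simp: circumscribes_def side_tangent_def len)
    then have "affine hull {E x, vertex P (Suc i)} \<inter> ellipse (0, 0) a b = {T}"
      using side_mod(2)[of P i] by (simp add: len sideline_def that)
    then show ?thesis
      using tangent_chord_step[OF a b c\<beta> inE[of "Suc i"], of x T] ne1[of i]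
      by (simp add: that flip: E_def)
  qed
  obtain t where t: "vertex P 0 = E t"
    using in_ellipse_point[OF inE[of 0]] a b c\<beta> unfolding E_def by auto
  \<comment> \<open>The first side fixes the orientation, that is, the sign of
    \<open>\<delta>\<close>.\<close>
  obtain \<delta> where \<delta>: "\<bar>\<delta>\<bar> = \<beta>" "vertex P 1 = E (t + 2 * \<delta>)"
    using step[OF t] \<beta> that[of \<beta>] that[of "- \<beta>"]
    by (metis One_nat_def abs_minus_cancel abs_of_pos diff_conv_add_uminus mult_minus_right)
  \<comment> \<open>Two consecutive vertices are carried through the induction: the next step has
    two candidates, and the backward one would repeat \<open>vertex P i\<close>, which
    \<open>ne2\<close> forbids.\<close>
  have "vertex P i = E (t + 2 * \<delta> * real i) \<and> vertex P (Suc i) = E (t + 2 * \<delta> * real (Suc i))" for i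
  proof (induction i)
    case 0
    then show ?case using t \<delta> by simp
  next
    case (Suc i)
    define x where "x = t + 2 * \<delta> * real (Suc i)"
    have x: "t + 2 * \<delta> * real i = x - 2 * \<delta>" "t + 2 * \<delta> * real (Suc (Suc i)) = x + 2 * \<delta>"
      by (simp_all add: x_def algebra_simps)
    have vi: "vertex P i = E (x - 2 * \<delta>)" "vertex P (Suc i) = E x"
      using Suc unfolding x x_def[symmetric] by auto
    have "vertex P (Suc (Suc i)) = E (x + 2 * \<delta>) \<or> vertex P (Suc (Suc i)) = E (x - 2 * \<delta>)"
      using step[OF vi(2)] \<delta>(1) by (cases "\<delta> \<ge> 0") auto
    then have "vertex P (Suc (Suc i)) = E (x + 2 * \<delta>)" using ne2[of i] vi by auto
    then show ?case using vi unfolding x x_def[symmetric] by simp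
  qed
  then have vertex: "vertex P i = E (t + 2 * \<delta> * real i)" for i by blast
  have cos_\<delta>: "cos (x * \<delta>) = cos (x * \<beta>)" for x
    using \<delta>(1) by (auto simp: abs_if split: if_splits)
  have "vertex P N = vertex P 0" by (simp add: vertex_def len)
  then have "E (t + 2 * \<delta> * real N) = E t" using vertex[of N] t by simp
  then obtain l :: int where "t + 2 * \<delta> * real N = t + 2 * pi * of_int l"
    using a b c\<beta> sin_cos_eq_iff[of "t + 2 * \<delta> * real N" t]
    by (auto simp: E_def ellipse_point_inject)
  then have "\<delta> * real N = pi * of_int l" by simp
  then have "\<bar>\<delta>\<bar> * real N = pi * of_int \<bar>l\<bar>"
    using abs_mult[of \<delta> "real N"] abs_mult[of pi "of_int l"] by simp
  then have k: "real N * \<beta> = pi * of_int \<bar>l\<bar>" using \<delta> by (simp add: mult.commute)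
  \<comment> \<open>Convexity at the first side alone suffices to exclude several turns.\<close>
  obtain n d where n: "n \<bullet> vertex P 0 = d" "n \<bullet> vertex P (Suc 0) = d"
    "\<And>j. j < N \<Longrightarrow> j \<noteq> 0 \<Longrightarrow> j \<noteq> Suc 0 mod N \<Longrightarrow> n \<bullet> vertex P j < d"
    using conv N unfolding convex_polygon_def len
    by (metis (no_types, lifting) gr0I not_numeral_le_zero)
  obtain n1 n2 where n12: "n = (n1, n2)" by (cases n)
  define u v where "u = n1 * a / cos \<beta>" and "v = n2 * b / cos \<beta>"
  have nE: "n \<bullet> E x = u * cos x + v * sin x" for x
    by (simp add: n12 E_def ellipse_point_def u_def v_def)
  \<comment> \<open>\<open>y\<close> is the parameter halfway along the first side. Since
    \<open>n\<close> takes equal values at both ends, \<open>n \<bullet> E (y + x)\<close> reduces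
    to \<open>r * cos x\<close>, and convexity becomes a comparison of cosines.\<close>
  define y where "y = t + \<delta>"
  have d: "u * cos (y - \<delta>) + v * sin (y - \<delta>) = d" "u * cos (y + \<delta>) + v * sin (y + \<delta>) = d"
    using n(1,2) vertex[of 0] vertex[of "Suc 0"] by (simp_all add: nE y_def algebra_simps)
  have "sin \<beta> > 0" using \<beta> by (intro sin_gt_zero) auto
  then have s\<delta>: "sin \<delta> \<noteq> 0" using \<delta>(1) by (auto simp: abs_if split: if_splits)
  define r where "r = u * cos y + v * sin y"
  have "u * cos (y + \<delta>) + v * sin (y + \<delta>) - (u * cos (y - \<delta>) + v * sin (y - \<delta>)) = 0"
    using d by simp
  then have "2 * (sin \<delta> * (v * cos y - u * sin y)) = 0"
    unfolding cos_add cos_diff sin_add sin_diff by (simp add: algebra_simps)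
  then have perp: "v * cos y = u * sin y" using s\<delta> by simp
  have nE': "n \<bullet> E (y + x) = r * cos x" for x
  proof -
    have "n \<bullet> E (y + x) = r * cos x + (v * cos y - u * sin y) * sin x"
      unfolding nE r_def cos_add sin_add by (simp add: algebra_simps)
    then show ?thesis using perp by simp
  qed
  have d_eq: "d = r * cos \<beta>"
    using nE'[of \<delta>] n(2) vertex[of "Suc 0"] cos_\<delta>[of 1] by (simp add: y_def algebra_simps)
  have less: "r * cos ((2 * real j - 1) * \<beta>) < r * cos \<beta>" if "2 \<le> j" "j < N" for j
  proof -
    have "n \<bullet> vertex P j < d" using n(3)[of j] that by simp
    moreover have "t + 2 * \<delta> * real j = y + (2 * real j - 1) * \<delta>"
      by (simp add: y_def algebra_simps)
    ultimately show ?thesis using vertex[of j] by (simp only: nE' cos_\<delta> d_eq)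
  qed
  \<comment> \<open>The sign of \<open>r\<close> is still open; vertex 2, not an endpoint of the
    first side, decides it.\<close>
  have "cos (3 * \<beta>) < cos \<beta>"
  proof -
    have "cos (2 * \<beta> - \<beta>) - cos (2 * \<beta> + \<beta>) = 2 * (sin (2 * \<beta>) * sin \<beta>)"
      unfolding cos_diff cos_add by simp
    moreover have "0 < sin (2 * \<beta>) * sin \<beta>"
      using \<beta> by (intro mult_pos_pos sin_gt_zero) auto
    ultimately show ?thesis by simp
  qed
  moreover have "r * cos (3 * \<beta>) < r * cos \<beta>" using less[of 2] N by simp
  ultimately have r: "0 < r" by (auto simp: mult_less_cancel_left)
  have "real N * \<beta> = pi"
    using \<beta> k
  proof (rule cos_odd_multiples_less_imp_one_turn)
    show "cos ((2 * real j - 1) * \<beta>) < cos \<beta>" if "2 \<le> j" "j < N" for j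
      using less[OF that] r by simp
  qed (use N in simp)
  then show thesis using that \<delta>(1) vertex unfolding E_def by blast
qed

section \<open>Homothetic semiaxes and the assembly of the theorem\<close>

lemma ellipse_scaled_axes:
  assumes "0 < a" "0 < b" "0 < A" "0 < B" "0 < m"
    and eq: "ellipse (0, 0) A B = (\<lambda>p. m *\<^sub>R p) ` ellipse (0, 0) a b"
  shows "A = m * a" "B = m * b"
proof -
  have "(A, 0) \<in> ellipse (0, 0) A B" "(0, B) \<in> ellipse (0, 0) A B"
    using assms(1-5) by (simp_all add: ellipse_def)
  then obtain x y where x: "(A, 0) = m *\<^sub>R x" "x \<in> ellipse (0, 0) a b"
    and y: "(0, B) = m *\<^sub>R y" "y \<in> ellipse (0, 0) a b"
    unfolding eq by blast
  have "x = (A / m, 0)" "y = (0, B / m)"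
    using x(1) y(1) assms by (auto simp: prod_eq_iff)
  then have "(A / m / a)\<^sup>2 = 1" "(B / m / b)\<^sup>2 = 1"
    using x(2) y(2) by (simp_all add: ellipse_def)
  moreover have "0 < A / m / a" "0 < B / m / b" using assms by simp_all
  ultimately have "A / m / a = 1" "B / m / b = 1"
    by (auto simp: power2_eq_1_iff)
  then show "A = m * a" "B = m * b" using assms by (simp_all add: field_simps)
qed

theorem proposition5:
  fixes N :: nat
    and \<alpha> a\<^sub>H b\<^sub>H a\<^sub>h b\<^sub>h c\<^sub>h m k R\<^sub>1 x\<^sub>1 a\<^sub>1 b\<^sub>1 :: real
    and f\<^sub>h O\<^sub>1 :: point
    and E\<^sub>H E\<^sub>h E\<^sub>1 :: "point set"
    and \<H> :: "point list set"
  assumes "3 \<le> N" and "\<alpha> = pi / real N"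
    and "0 < a\<^sub>H" and "0 < b\<^sub>H" and "0 < b\<^sub>h" and "b\<^sub>h \<le> a\<^sub>h"
    and "E\<^sub>H = ellipse (0, 0) a\<^sub>H b\<^sub>H" and "E\<^sub>h = ellipse (0, 0) a\<^sub>h b\<^sub>h"
    and "1 < m" and "E\<^sub>H = (\<lambda>p. m *\<^sub>R p) ` E\<^sub>h"
    and "\<H> = poncelet_family N E\<^sub>H E\<^sub>h"
    and "0 \<le> c\<^sub>h" and "c\<^sub>h\<^sup>2 = a\<^sub>h\<^sup>2 - b\<^sub>h\<^sup>2" and "f\<^sub>h = (- c\<^sub>h, 0)"
    and "0 < k" and "k\<^sup>2 = a\<^sub>h\<^sup>2 - c\<^sub>h\<^sup>2 * (cos \<alpha>)\<^sup>2"
    and "O\<^sub>1 = (- c\<^sub>h * ((1 + b\<^sub>h\<^sup>2) / b\<^sub>h\<^sup>2), 0)"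
    and "R\<^sub>1 = a\<^sub>h / b\<^sub>h\<^sup>2"
    and "x\<^sub>1 = - (c\<^sub>h * (a\<^sub>h\<^sup>2 + (1 - c\<^sub>h\<^sup>2) * (cos \<alpha>)\<^sup>2) / k\<^sup>2)"
    and "a\<^sub>1 = a\<^sub>h * cos \<alpha> / k\<^sup>2"
    and "b\<^sub>1 = a\<^sub>h * cos \<alpha> / (b\<^sub>h * k)"
    and "E\<^sub>1 = ellipse (x\<^sub>1, 0) a\<^sub>1 b\<^sub>1"
  shows "\<forall>Q \<in> polar_image f\<^sub>h 1 ` \<H>.
           harmonic_polygon Q \<and>
           inscribed_in Q (sphere O\<^sub>1 R\<^sub>1) \<and>
           circumscribes Q E\<^sub>1 \<and>
           (\<forall>K. is_symmedian_point Q K \<longleftrightarrow> K = f\<^sub>h)"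
proof (rule ballI, elim imageE)
  fix R P assume R: "R = polar_image f\<^sub>h 1 P" and "P \<in> \<H>"
  \<comment> \<open>The half-angle is first read off from the homothety ratio \<open>m\<close>. That
    it equals \<open>\<alpha>\<close> follows only from the closing of the given polygon after one
    turn.\<close>
  define \<beta> where "\<beta> = arccos (1 / m)"
  have m: "- 1 < 1 / m" "0 < 1 / m" "1 / m < 1" using \<open>1 < m\<close> by (simp_all add: less_divide_eq)
  have cos_\<beta>: "cos \<beta> = 1 / m" unfolding \<beta>_def using m by (intro cos_arccos) linarith+
  have \<beta>: "0 < \<beta>" "\<beta> < pi / 2"
    using m arccos_less_arccos[of 0 "1 / m"] arccos_lt_bounded[OF m(1,3)] by (simp_all add: \<beta>_def)
  have a: "0 < a\<^sub>h" using \<open>0 < b\<^sub>h\<close> \<open>b\<^sub>h \<le> a\<^sub>h\<close> by simp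
  have "a\<^sub>H = m * a\<^sub>h" "b\<^sub>H = m * b\<^sub>h"
    using ellipse_scaled_axes[OF a \<open>0 < b\<^sub>h\<close> \<open>0 < a\<^sub>H\<close> \<open>0 < b\<^sub>H\<close>, of m] assms(7-10) by simp_all
  then have "a\<^sub>H = a\<^sub>h / cos \<beta>" "b\<^sub>H = b\<^sub>h / cos \<beta>" by (simp_all add: cos_\<beta>)
  then have P: "P \<in> poncelet_family N (ellipse (0, 0) (a\<^sub>h / cos \<beta>) (b\<^sub>h / cos \<beta>)) (ellipse (0, 0) a\<^sub>h b\<^sub>h)"
    using \<open>P \<in> \<H>\<close> assms(7,8,11) by simp
  obtain \<delta> t where \<delta>: "\<bar>\<delta>\<bar> = \<beta>" "real N * \<beta> = pi"
    and vertex: "\<And>i. vertex P i = ellipse_point (a\<^sub>h / cos \<beta>) (b\<^sub>h / cos \<beta>) (t + 2 * \<delta> * real i)"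
    using poncelet_family_vertices[OF a \<open>0 < b\<^sub>h\<close> \<beta> P] by blast
  have "\<beta> = \<alpha>" using assms(1,2) unfolding \<delta>(2)[symmetric] by simp
  have "cos \<bar>\<delta>\<bar> = cos \<delta>" by simp
  then have cos_\<delta>: "cos \<beta> = cos \<delta>" "cos \<alpha> = cos \<delta>"
    using \<delta>(1) \<open>\<beta> = \<alpha>\<close> by simp_all
  interpret affine_regular_polygon N a\<^sub>h b\<^sub>h c\<^sub>h \<delta> t P
  proof
    show "length P = N" using P by (simp add: poncelet_family_def)
    show "vertex P i = (a\<^sub>h / cos \<delta> * cos (t + 2 * \<delta> * real i), b\<^sub>h / cos \<delta> * sin (t + 2 * \<delta> * real i))" for i
      unfolding vertex ellipse_point_def cos_\<delta>(1) ..
  qed (use assms a \<delta> in simp_all)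
  have focus: "focus = f\<^sub>h" by (simp add: focus_def assms(14))
  have "R = Q" unfolding R Q_def focus ..
  then show "harmonic_polygon R \<and> inscribed_in R (sphere O\<^sub>1 R\<^sub>1) \<and> circumscribes R E\<^sub>1 \<and>
      (\<forall>K. is_symmedian_point R K \<longleftrightarrow> K = f\<^sub>h)"
    using harmonic_Q inscribed_Q circumscribes_Q[of k] symmedian_focus symmedian_unique assms(15,16)
    unfolding assms(17-22) cos_\<delta> focus by blast
qed

end
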